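(* The function $f(\zeta_1,\zeta_2,\eta_0,\eta,\psi_1,\psi_2)=g(\zeta_1,\zeta_2,\eta_0,\eta,\psi_1,\psi_2,1)$, where $g$ is the modified action, is a solution to the generalized Hamilton–Jacobi equation $$\psi_1\frac{\partial f}{\partial\psi_1}+\psi_2\frac{\partial f}{\partial\psi_2}+H(\zeta_1,\zeta_2,\eta,\nabla f)=f.$$
   Context: Hyperspherical coordinates $(\zeta_1,\zeta_2,\eta)$ on the unit sphere $\mathbb S^3\subset\mathbb R^4$ are given by $x_1+ix_2=e^{i\zeta_1}\cos\eta$, $x_3+ix_4=e^{i\zeta_2}\sin\eta$, $\eta\in(0,\pi/2)$, $\zeta_1,\zeta_2\in[-\pi,\pi)$, with dual covector variables $\psi_1,\psi_2,\theta$. The Hamiltonian is $$H(\zeta_1,\zeta_2,\eta,\psi_1,\psi_2,\theta)=\tfrac12\big(\psi_1^2\tan^2\eta+\psi_2^2\cot^2\eta+4\theta^2+2\psi_1\psi_2\big),$$ and $H(\zeta_1,\zeta_2,\eta,\nabla f)$ means that $(\psi_1,\psi_2,\theta)$ is replaced by $\nabla f=\big(\frac{\partial f}{\partial\zeta_1},\frac{\partial f}{\partial\zeta_2},\frac{\partial f}{\partial\eta}\big)$. The Hamiltonian system is $\dot\zeta_1=\psi_1\tan^2\eta+\psi_2$, $\dot\zeta_2=\psi_2\cot^2\eta+\psi_1$, $\dot\eta=4\theta$, $\dot\psi_1=\dot\psi_2=0$, $\dot\theta=-\psi_1^2\frac{\tan\eta}{\cos^2\eta}+\psi_2^2\frac{\cot\eta}{\sin^2\eta}$.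 It is solved on $s\in[0,t]$ with the mixed boundary conditions $\eta(0)=\eta_0$, $\eta(t)=\eta$, $\zeta_1(t)=\zeta_1$, $\zeta_2(t)=\zeta_2$, $\psi_1(0)=\psi_1$, $\psi_2(0)=\psi_2$. The modified action, defined on solutions to this problem, is $$g(\zeta_1,\zeta_2,\eta_0,\eta,\psi_1,\psi_2,t)=\psi_1\zeta_1+\psi_2\zeta_2+\int_0^t\big(\theta(s)\dot\eta(s)-H\big)\,ds.$$ The boundary data allow a countable number of possible values of the constant of integration $\theta_0=\theta(0)$; the value is not specified. The modified action satisfies the stretching property $g(\zeta_1,\zeta_2,\eta_0,\eta,\psi_1,\psi_2,t)=\lambda\, g(\zeta_1,\zeta_2,\eta_0,\eta,\frac{\psi_1}{\lambda},\frac{\psi_2}{\lambda},\lambda t)$. *)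

theory Defs
  imports "HOL-Analysis.Analysis"
begin

definition Ham :: "real \<Rightarrow> real \<Rightarrow> real \<Rightarrow> real \<Rightarrow> real \<Rightarrow> real \<Rightarrow> real" where
  "Ham \<zeta>1 \<zeta>2 \<eta> \<psi>1 \<psi>2 \<theta> =
     (\<psi>1\<^sup>2 * (tan \<eta>)\<^sup>2 + \<psi>2\<^sup>2 * (cot \<eta>)\<^sup>2 + 4 * \<theta>\<^sup>2 + 2 * \<psi>1 * \<psi>2) / 2"

text \<open>
  The angles are taken along the lifted curve, as real-valued continuous functions of time,
  so that a trajectory may leave the fundamental range from \<open>-pi\<close> to \<open>pi\<close> without a jump.
\<close>

definition hamiltonian_solution ::
  "real \<Rightarrow> (real \<Rightarrow> real) \<Rightarrow> (real \<Rightarrow> real) \<Rightarrow> (real \<Rightarrow> real) \<Rightarrow>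
   (real \<Rightarrow> real) \<Rightarrow> (real \<Rightarrow> real) \<Rightarrow> (real \<Rightarrow> real) \<Rightarrow> bool" where
  "hamiltonian_solution t \<zeta>1 \<zeta>2 \<eta> \<psi>1 \<psi>2 \<theta> \<longleftrightarrow>
     (\<forall>s\<in>{0..t}.
        \<eta> s \<in> {0<..<pi/2} \<and>
        (\<zeta>1 has_real_derivative \<psi>1 s * (tan (\<eta> s))\<^sup>2 + \<psi>2 s) (at s within {0..t}) \<and>
        (\<zeta>2 has_real_derivative \<psi>2 s * (cot (\<eta> s))\<^sup>2 + \<psi>1 s) (at s within {0..t}) \<and>
        (\<eta> has_real_derivative 4 * \<theta> s) (at s within {0..t}) \<and>
        (\<psi>1 has_real_derivative 0) (at s within {0..t}) \<and>
        (\<psi>2 has_real_derivative 0) (at s within {0..t}) \<and>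
        (\<theta> has_real_derivative
            - (\<psi>1 s)\<^sup>2 * (tan (\<eta> s) / (cos (\<eta> s))\<^sup>2)
            + (\<psi>2 s)\<^sup>2 * (cot (\<eta> s) / (sin (\<eta> s))\<^sup>2)) (at s within {0..t}))"

text \<open>
  \<open>modified_action_value \<zeta>1 \<zeta>2 \<eta>0 \<eta> \<psi>1 \<psi>2 t \<theta>0 v\<close>: the mixed boundary value problem has a solution
  with constant of integration \<open>\<theta>0\<close>, and \<open>v\<close> is the modified action of it. The boundary data
  alone do not determine \<open>\<theta>0\<close>.
\<close>

definition modified_action_value ::
  "real \<Rightarrow> real \<Rightarrow> real \<Rightarrow> real \<Rightarrow> real \<Rightarrow> real \<Rightarrow> real \<Rightarrow> real \<Rightarrow> real \<Rightarrow> bool" where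
  "modified_action_value \<zeta>1 \<zeta>2 \<eta>0 \<eta> \<psi>1 \<psi>2 t \<theta>0 v \<longleftrightarrow>
     0 < t \<and>
     (\<exists>z1 z2 h p1 p2 \<theta>.
        hamiltonian_solution t z1 z2 h p1 p2 \<theta> \<and>
        h 0 = \<eta>0 \<and> h t = \<eta> \<and> z1 t = \<zeta>1 \<and> z2 t = \<zeta>2 \<and> p1 0 = \<psi>1 \<and> p2 0 = \<psi>2 \<and>
        \<theta> 0 = \<theta>0 \<and>
        v = \<psi>1 * \<zeta>1 + \<psi>2 * \<zeta>2 +
            integral {0..t} (\<lambda>s. \<theta> s * vector_derivative h (at s within {0..t})
                                 - Ham (z1 s) (z2 s) (h s) (p1 s) (p2 s) (\<theta> s)))"

text \<open>
  The modified action as a function of the boundary data is a branch of the multivalued expression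
  above: on the set \<open>D\<close> of boundary data the constant of integration is selected continuously, with
  no other restriction on the selection. Without continuity, unrelated solutions could be picked at
  neighbouring points, and partial derivatives would be meaningless. No smoothness
  of the selection is required.
\<close>

definition modified_action ::
  "(real \<times> real \<times> real \<times> real \<times> real \<times> real \<times> real) set \<Rightarrow>
   (real \<Rightarrow> real \<Rightarrow> real \<Rightarrow> real \<Rightarrow> real \<Rightarrow> real \<Rightarrow> real \<Rightarrow> real) \<Rightarrow> bool" where
  "modified_action D g \<longleftrightarrow>
     (\<exists>\<theta>0. continuous_on D \<theta>0 \<and>
        (\<forall>(\<zeta>1, \<zeta>2, \<eta>0, \<eta>, \<psi>1, \<psi>2, t) \<in> D.
           modified_action_value \<zeta>1 \<zeta>2 \<eta>0 \<eta> \<psi>1 \<psi>2 t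
             (\<theta>0 (\<zeta>1, \<zeta>2, \<eta>0, \<eta>, \<psi>1, \<psi>2, t)) (g \<zeta>1 \<zeta>2 \<eta>0 \<eta> \<psi>1 \<psi>2 t)))"

text \<open>
  Classical solutions. Joint differentiability guarantees that every \<open>deriv\<close> below
  is a genuine partial derivative.
\<close>

definition solves_generalized_HJ ::
  "(real \<times> real \<times> real \<times> real \<times> real \<times> real) set \<Rightarrow>
   (real \<Rightarrow> real \<Rightarrow> real \<Rightarrow> real \<Rightarrow> real \<Rightarrow> real \<Rightarrow> real) \<Rightarrow> bool" where
  "solves_generalized_HJ U f \<longleftrightarrow>
     (\<forall>(\<zeta>1, \<zeta>2, \<eta>0, \<eta>, \<psi>1, \<psi>2) \<in> U.
        (\<lambda>(\<zeta>1, \<zeta>2, \<eta>0, \<eta>, \<psi>1, \<psi>2). f \<zeta>1 \<zeta>2 \<eta>0 \<eta> \<psi>1 \<psi>2)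
          differentiable at (\<zeta>1, \<zeta>2, \<eta>0, \<eta>, \<psi>1, \<psi>2) \<and>
        \<psi>1 * deriv (\<lambda>x. f \<zeta>1 \<zeta>2 \<eta>0 \<eta> x \<psi>2) \<psi>1 +
        \<psi>2 * deriv (\<lambda>x. f \<zeta>1 \<zeta>2 \<eta>0 \<eta> \<psi>1 x) \<psi>2 +
        Ham \<zeta>1 \<zeta>2 \<eta>
          (deriv (\<lambda>x. f x \<zeta>2 \<eta>0 \<eta> \<psi>1 \<psi>2) \<zeta>1)
          (deriv (\<lambda>x. f \<zeta>1 x \<eta>0 \<eta> \<psi>1 \<psi>2) \<zeta>2)
          (deriv (\<lambda>x. f \<zeta>1 \<zeta>2 \<eta>0 x \<psi>1 \<psi>2) \<eta>)
        = f \<zeta>1 \<zeta>2 \<eta>0 \<eta> \<psi>1 \<psi>2)"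

end

theory Submission
  imports Defs
begin

text \<open>
  The momenta \<open>\<psi>1\<close> and \<open>\<psi>2\<close> are constants of motion, so \<open>(\<eta>, \<theta>)\<close> performs a one-dimensional
  motion with energy \<open>H\<close>, and \<open>f = \<psi>1 * \<zeta>1 + \<psi>2 * \<zeta>2 + A\<close>, where \<open>A\<close> is the action of that motion. The
  first variation of the action (lemma \<open>first_variation\<close>) suggests
  \<open>dA = \<theta>(1) d\<eta> - \<theta>(0) d\<eta>0 - (\<zeta>1(1) - \<zeta>1(0)) d\<psi>1 - (\<zeta>2(1) - \<zeta>2(0)) d\<psi>2\<close>. Hence the gradient of \<open>f\<close> in
  \<open>(\<zeta>1, \<zeta>2, \<eta>)\<close> is the final covector \<open>(\<psi>1, \<psi>2, \<theta>(1))\<close>, and the derivative of \<open>f\<close> in \<open>\<psi>i\<close> is the initial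
  angle \<open>\<zeta>i(0)\<close>. The generalized Hamilton--Jacobi equation then says that \<open>H\<close> is the action plus
  the sum of \<open>\<psi>i * (\<zeta>i(1) - \<zeta>i(0))\<close>. This follows from conservation of \<open>H\<close> and from its homogeneity
  in the covector (lemma \<open>energy_equals_action_balance\<close>).

  The real difficulty is that \<open>f\<close> is differentiable at all. The constant of integration \<open>\<theta>(0)\<close> is only
  a continuous function of the boundary data, and it need not be Lipschitz where the end point
  is conjugate to the starting point. The error in the first variation is quadratic in the change of
  \<open>\<theta>(0)\<close>, which does not make it negligible against the change of the boundary data. The way out is
  one-dimensional: the other data and \<open>\<theta>(0)\<close> determine \<open>\<eta>\<close>, so that for fixed other data
  \<open>\<theta>(0)\<close> is a continuous injective, hence monotone, function of \<open>\<eta>\<close>. Over a fine partition the squares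
  of the increments of a continuous monotone function sum to almost nothing, and so the quadratic errors
  disappear (lemmas \<open>nonincreasing_if_quadratic_increments\<close> and \<open>has_derivative_of_quadratic_error\<close>).
  The remaining input is uniform Lipschitz dependence of trajectories on their data, which is Gronwall's
  inequality together with a first-exit argument that keeps nearby trajectories away from the
  singularities of \<open>tan\<close> and \<open>cot\<close>.
\<close>

section \<open>Derivatives in the presence of quadratic errors\<close>

text \<open>
  On a fine partition the increments of \<open>\<phi>\<close> add up to at most \<open>C\<close> times the sum of
  \<open>(\<Delta>\<tau>)\<^sup>2\<close>, and for continuous monotone \<open>\<tau>\<close> that sum is at most the largest \<open>\<Delta>\<tau>\<close> times
  \<open>\<tau> b - \<tau> a\<close>, which tends to zero. Bolzano's bisection principle replaces the partition.
  A typical \<open>\<tau>\<close> is the cube root near \<open>0\<close>, for which \<open>(\<Delta>\<tau>)\<^sup>2\<close> alone is much larger than the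
  increment of the argument.
\<close>
lemma nonincreasing_if_quadratic_increments:
  fixes \<phi> \<tau> :: "real \<Rightarrow> real"
  assumes ab: "a \<le> b" and cont: "continuous_on {a..b} \<tau>" and mono: "mono_on {a..b} \<tau>"
    and inc: "\<And>x y. a \<le> x \<Longrightarrow> x \<le> y \<Longrightarrow> y \<le> b \<Longrightarrow> \<phi> y - \<phi> x \<le> C * (\<tau> y - \<tau> x)\<^sup>2"
  shows "\<phi> b \<le> \<phi> a"
proof -
  \<comment> \<open>The slope \<open>\<gamma>\<close> in \<open>\<tau>\<close> absorbs the squared increment as soon as \<open>C * \<Delta>\<tau> \<le> \<gamma>\<close>, which holds locally.\<close>
  have slack: "\<phi> b - \<phi> a \<le> \<gamma> * (\<tau> b - \<tau> a)" if \<gamma>: "\<gamma> > 0" for \<gamma>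
  proof -
    define P where "P = (\<lambda>x y. a \<le> x \<longrightarrow> y \<le> b \<longrightarrow> \<phi> y - \<gamma> * \<tau> y \<le> \<phi> x - \<gamma> * \<tau> x)"
    have "P a b"
      using ab
    proof (induction rule: Bolzano)
      case (trans x y z)
      then show ?case unfolding P_def by force
    next
      case (local x)
      then have "\<forall>e>0. \<exists>d>0. \<forall>y\<in>{a..b}. dist y x < d \<longrightarrow> dist (\<tau> y) (\<tau> x) < e"
        using cont unfolding continuous_on_iff by simp
      moreover have "\<gamma> / (2 * (\<bar>C\<bar> + 1)) > 0" using \<gamma> by simp
      ultimately obtain d where d: "d > 0"
        "\<And>y. y \<in> {a..b} \<Longrightarrow> dist y x < d \<Longrightarrow> dist (\<tau> y) (\<tau> x) < \<gamma> / (2 * (\<bar>C\<bar> + 1))"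
        by blast
      have "P u v" if uv: "u \<le> x" "x \<le> v" "v - u < d" for u v
        unfolding P_def
      proof (intro impI)
        assume au: "a \<le> u" and vb: "v \<le> b"
        have "dist (\<tau> u) (\<tau> x) < \<gamma> / (2 * (\<bar>C\<bar> + 1))" "dist (\<tau> v) (\<tau> x) < \<gamma> / (2 * (\<bar>C\<bar> + 1))"
          using d(2)[of u] d(2)[of v] uv au vb by (auto simp: dist_real_def)
        then have "\<tau> v - \<tau> u \<le> 2 * (\<gamma> / (2 * (\<bar>C\<bar> + 1)))"
          by (simp only: dist_real_def abs_less_iff) argo
        then have small: "(\<bar>C\<bar> + 1) * (\<tau> v - \<tau> u) \<le> \<gamma>" by (simp add: field_simps)
        have nn: "0 \<le> \<tau> v - \<tau> u" using mono uv au vb by (auto simp: mono_on_def)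
        have "\<phi> v - \<phi> u \<le> C * (\<tau> v - \<tau> u)\<^sup>2" using inc uv au vb by simp
        also have "\<dots> \<le> (\<bar>C\<bar> + 1) * (\<tau> v - \<tau> u)\<^sup>2" by (intro mult_right_mono) auto
        also have "\<dots> = ((\<bar>C\<bar> + 1) * (\<tau> v - \<tau> u)) * (\<tau> v - \<tau> u)" by (simp add: power2_eq_square)
        also have "\<dots> \<le> \<gamma> * (\<tau> v - \<tau> u)" using small nn by (intro mult_right_mono)
        finally show "\<phi> v - \<gamma> * \<tau> v \<le> \<phi> u - \<gamma> * \<tau> u" by (simp add: algebra_simps)
      qed
      then show ?case using d(1) by blast
    qed
    then show ?thesis unfolding P_def by (simp add: algebra_simps)
  qed
  have nn: "0 \<le> \<tau> b - \<tau> a" using mono ab by (auto simp: mono_on_def)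
  have "\<phi> b - \<phi> a \<le> 0 + e" if "e > 0" for e
  proof -
    have "\<phi> b - \<phi> a \<le> e / (\<tau> b - \<tau> a + 1) * (\<tau> b - \<tau> a)" using slack[of "e / (\<tau> b - \<tau> a + 1)"] nn that by simp
    also have "\<dots> \<le> e" using nn that by (simp add: field_simps)
    finally show ?thesis by simp
  qed
  then have "\<phi> b - \<phi> a \<le> 0" by (rule field_le_epsilon)
  then show ?thesis by simp
qed

text \<open>
  The error of the first-order expansion of \<open>A\<close> is quadratic in the increment of the auxiliary
  variable \<open>\<tau>\<close>, not of \<open>x\<close>, and \<open>\<tau>\<close> is not Lipschitz in \<open>x\<close> in general. Being continuous and
  injective on an interval it is monotone, so the preceding lemma removes the quadratic error,
  and \<open>A\<close> behaves as if it had slope \<open>P\<close>.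
\<close>
lemma increment_bound_of_quadratic_error:
  fixes A P \<tau> :: "real \<Rightarrow> real"
  assumes cont: "continuous_on {a..b} \<tau>" and inj: "inj_on \<tau> {a..b}"
    and err: "\<And>x y. x \<in> {a..b} \<Longrightarrow> y \<in> {a..b} \<Longrightarrow> \<bar>A y - A x - P x * (y - x)\<bar> \<le> C * (\<tau> y - \<tau> x)\<^sup>2"
    and P: "\<And>x. x \<in> {a..b} \<Longrightarrow> \<bar>P x - c\<bar> \<le> \<epsilon>"
    and xy: "x \<in> {a..b}" "y \<in> {a..b}"
  shows "\<bar>A y - A x - c * (y - x)\<bar> \<le> \<epsilon> * \<bar>y - x\<bar>"
proof -
  obtain \<sigma> where \<sigma>: "mono_on {a..b} \<sigma>" "continuous_on {a..b} \<sigma>" "\<And>x y. (\<sigma> y - \<sigma> x)\<^sup>2 = (\<tau> y - \<tau> x)\<^sup>2"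
  proof -
    have "strict_mono_on {a..b} \<tau> \<or> strict_antimono_on {a..b} \<tau>"
      using injective_eq_monotone_map[of "{a..b}" \<tau>] cont inj by (simp add: is_interval_cc)
    then consider "mono_on {a..b} \<tau>" | "mono_on {a..b} (\<lambda>x. - \<tau> x)"
      by (force simp: monotone_on_def le_less)
    then show ?thesis
    proof cases
      case 1 then show ?thesis using that cont by blast
    next
      case 2
      show ?thesis
        by (rule that[OF 2]) (auto intro: continuous_intros cont simp: power2_eq_square algebra_simps)
    qed
  qed
  have main: "\<bar>A v - A u - c * (v - u)\<bar> \<le> \<epsilon> * (v - u)" if uv: "u \<in> {a..b}" "v \<in> {a..b}" "u \<le> v" for u v
  proof -
    have sub: "{u..v} \<subseteq> {a..b}" using uv by auto
    have m: "mono_on {u..v} \<sigma>" "continuous_on {u..v} \<sigma>"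
      using \<sigma> sub by (auto intro: mono_on_subset continuous_on_subset)
    have step: "\<bar>A y - A x - c * (y - x)\<bar> \<le> \<epsilon> * (y - x) + C * (\<sigma> y - \<sigma> x)\<^sup>2"
      if "u \<le> x" "x \<le> y" "y \<le> v" for x y
    proof -
      have "\<bar>A y - A x - P x * (y - x)\<bar> \<le> C * (\<sigma> y - \<sigma> x)\<^sup>2" using err uv that \<sigma>(3) by auto
      moreover have "\<bar>(P x - c) * (y - x)\<bar> \<le> \<epsilon> * (y - x)"
        unfolding abs_mult using P[of x] uv that by (simp add: mult_right_mono)
      moreover have "A y - A x - c * (y - x) = (A y - A x - P x * (y - x)) + (P x - c) * (y - x)"
        by (simp add: algebra_simps)
      ultimately show ?thesis by linarith
    qed
    have "(\<lambda>x. A x - (c + \<epsilon>) * x) v \<le> (\<lambda>x. A x - (c + \<epsilon>) * x) u"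
      by (rule nonincreasing_if_quadratic_increments[OF uv(3) m(2,1), of _ C])
        (drule (2) step, simp add: algebra_simps abs_le_iff)
    moreover have "(\<lambda>x. - A x - (\<epsilon> - c) * x) v \<le> (\<lambda>x. - A x - (\<epsilon> - c) * x) u"
      by (rule nonincreasing_if_quadratic_increments[OF uv(3) m(2,1), of _ C])
        (drule (2) step, simp add: algebra_simps abs_le_iff)
    ultimately show ?thesis by (simp add: algebra_simps abs_le_iff)
  qed
  show ?thesis
  proof (cases "x \<le> y")
    case True then show ?thesis using main[of x y] xy by simp
  next
    case False
    then show ?thesis using main[of y x] xy by (simp add: algebra_simps abs_le_iff) 
  qed
qed

text \<open>
  An envelope theorem that covers degenerate parameters. The value \<open>A\<close> is attached to a
  continuously selected parameter \<open>\<Theta>\<close>, and its expansions have errors that are quadratic in the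
  increment of \<open>\<Theta>\<close>. That increment need not be bounded by a
  multiple of the increment of the arguments. Therefore one moves in two legs: from
  \<open>(y0, \<eta>0)\<close> to the point \<open>(y, u)\<close> over \<open>y\<close> with the same value of \<open>\<Theta>\<close>, where the quadratic term in \<open>\<Theta>\<close> vanishes, and
  then along the fibre over \<open>y\<close>, where \<open>\<Theta>\<close> is injective (hypothesis \<open>lip\<close>) and the quadratic
  term does not matter by the preceding lemma. The same hypothesis bounds \<open>u - \<eta>0\<close> by
  \<open>y - y0\<close>.
\<close>
lemma has_derivative_of_quadratic_error:
  fixes \<Theta> A P :: "'a::real_normed_vector \<times> real \<Rightarrow> real" and l :: "'a \<Rightarrow> real"
  assumes W: "open W" "(y0, \<eta>0) \<in> W" and cont: "continuous_on W \<Theta>" and P: "isCont P (y0, \<eta>0)"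
    and l: "bounded_linear l" and C: "0 \<le> C"
    and lip: "\<And>y \<eta> y' \<eta>'. (y, \<eta>) \<in> W \<Longrightarrow> (y', \<eta>') \<in> W \<Longrightarrow>
       \<bar>\<eta>' - \<eta>\<bar> \<le> C * (norm (y' - y) + \<bar>\<Theta> (y', \<eta>') - \<Theta> (y, \<eta>)\<bar>)"
    and fibre: "\<And>y \<eta> \<eta>'. (y, \<eta>) \<in> W \<Longrightarrow> (y, \<eta>') \<in> W \<Longrightarrow>
       \<bar>A (y, \<eta>') - A (y, \<eta>) - P (y, \<eta>) * (\<eta>' - \<eta>)\<bar> \<le> C * (\<Theta> (y, \<eta>') - \<Theta> (y, \<eta>))\<^sup>2"
    and base: "\<And>y \<eta>. (y, \<eta>) \<in> W \<Longrightarrow>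
       \<bar>A (y, \<eta>) - A (y0, \<eta>0) - P (y0, \<eta>0) * (\<eta> - \<eta>0) - l (y - y0)\<bar>
         \<le> C * ((norm (y - y0))\<^sup>2 + (\<Theta> (y, \<eta>) - \<Theta> (y0, \<eta>0))\<^sup>2)"
  shows "(A has_derivative (\<lambda>(dy, d\<eta>). l dy + P (y0, \<eta>0) * d\<eta>)) (at (y0, \<eta>0))"
  unfolding has_derivative_at_alt
proof (intro conjI allI impI)
  show "bounded_linear (\<lambda>(dy, d\<eta>). l dy + P (y0, \<eta>0) * d\<eta>)"
    unfolding case_prod_beta
    by (intro bounded_linear_add bounded_linear_compose[OF l] bounded_linear_fst
        bounded_linear_const_mult bounded_linear_snd)
next
  fix e :: real assume e: "e > 0"
  let ?w = "(y0, \<eta>0)"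
  define \<epsilon> where "\<epsilon> = e / (2 * (C + 1))"
  have \<epsilon>: "\<epsilon> > 0" using e C by (simp add: \<epsilon>_def)
  obtain r1 where r1: "r1 > 0" "ball ?w r1 \<subseteq> W" using W openE by blast
  obtain r2 where r2: "r2 > 0" "\<And>w. dist w ?w < r2 \<Longrightarrow> dist (P w) (P ?w) < \<epsilon>"
    using P \<epsilon> unfolding continuous_at_eps_delta by blast
  define \<delta> where "\<delta> = min r1 r2 / 3"
  have \<delta>: "\<delta> > 0" using r1 r2 by (simp add: \<delta>_def)
  have near: "dist (y, \<eta>) ?w < min r1 r2" if "dist y y0 < \<delta>" "\<eta> \<in> {\<eta>0 - \<delta>..\<eta>0 + \<delta>}" for y \<eta>
  proof -
    have "dist (y, \<eta>) ?w \<le> dist y y0 + dist \<eta> \<eta>0"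
      by (simp add: dist_Pair_Pair sqrt_sum_squares_le_sum)
    also have "\<dots> < \<delta> + 2 * \<delta>" using that \<delta> by (auto simp: dist_real_def)
    also have "\<dots> = min r1 r2" by (simp add: \<delta>_def)
    finally show ?thesis .
  qed
  have inW: "(y, \<eta>) \<in> W" if "dist y y0 < \<delta>" "\<eta> \<in> {\<eta>0 - \<delta>..\<eta>0 + \<delta>}" for y \<eta>
    using near[OF that] r1(2) by (auto simp: dist_commute)
  have Pnear: "\<bar>P (y, \<eta>) - P ?w\<bar> \<le> \<epsilon>" if "dist y y0 < \<delta>" "\<eta> \<in> {\<eta>0 - \<delta>..\<eta>0 + \<delta>}" for y \<eta>
    using r2(2)[of "(y, \<eta>)"] near[OF that] by (simp add: dist_real_def)
  let ?I = "{\<eta>0 - \<delta>..\<eta>0 + \<delta>}"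
  have fc: "continuous_on ?I (\<lambda>\<eta>. \<Theta> (y, \<eta>))" if "dist y y0 < \<delta>" for y
    by (rule continuous_on_compose2[OF cont]) (use that inW in \<open>auto intro!: continuous_intros\<close>)
  have fi: "inj_on (\<lambda>\<eta>. \<Theta> (y, \<eta>)) ?I" if "dist y y0 < \<delta>" for y
  proof (rule inj_onI)
    fix u v assume "u \<in> ?I" "v \<in> ?I" "\<Theta> (y, u) = \<Theta> (y, v)"
    then show "u = v" using lip[of y u y v] inW[OF that] by simp
  qed
  \<comment> \<open>At \<open>y0\<close> the value \<open>\<Theta> (y0, \<eta>0)\<close> lies strictly between the values at the two ends of the fibre,
    which is an open condition on \<open>y\<close>; it is recorded as the sign of a product because
    \<open>\<Theta>\<close> may increase or decrease along fibres.\<close>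
  define s where "s = (\<lambda>y. (\<Theta> (y, \<eta>0 - \<delta>) - \<Theta> ?w) * (\<Theta> (y, \<eta>0 + \<delta>) - \<Theta> ?w))"
  have "s y0 < 0"
    using continuous_inj_imp_mono[of "\<eta>0 - \<delta>" \<eta>0 "\<eta>0 + \<delta>", OF _ _ fc[of y0] fi[of y0]] \<delta>
    by (auto simp: s_def mult_less_0_iff)
  have "continuous_on (ball y0 \<delta>) s"
    unfolding s_def
    by (intro continuous_intros continuous_on_compose2[OF cont])
      (use inW \<delta> in \<open>auto simp: dist_commute\<close>)
  then have "isCont s y0" using \<delta> by (simp add: continuous_on_eq_continuous_at)
  then obtain r3 where r3: "r3 > 0" "\<And>y. dist y y0 < r3 \<Longrightarrow> dist (s y) (s y0) < - s y0"
    using \<open>s y0 < 0\<close> unfolding continuous_at_eps_delta by (metis neg_0_less_iff_less)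
  define d where "d = min (min \<delta> r3) (e / (2 * (C + 1)))"
  have d: "d > 0" using \<delta> r3 e C by (simp add: d_def)
  have "norm (A w - A ?w - (case w - ?w of (dy, d\<eta>) \<Rightarrow> l dy + P ?w * d\<eta>)) \<le> e * norm (w - ?w)"
    if wd: "norm (w - ?w) < d" for w
  proof -
    obtain y \<eta> where w: "w = (y, \<eta>)" by (cases w)
    have ny: "norm (y - y0) \<le> norm (w - ?w)" "\<bar>\<eta> - \<eta>0\<bar> \<le> norm (w - ?w)"
      using norm_fst_le[of "y - y0" "\<eta> - \<eta>0"] norm_snd_le[of "\<eta> - \<eta>0" "y - y0"] unfolding w by auto
    have yd: "dist y y0 < \<delta>" "dist y y0 < r3" and eI: "\<eta> \<in> ?I" and ye: "norm (y - y0) \<le> e / (2 * (C + 1))"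
      using ny wd by (auto simp: d_def dist_norm abs_le_iff)
    have "s y < 0" using r3(2)[OF yd(2)] by (simp add: dist_real_def)
    then have "\<exists>u\<in>?I. \<Theta> (y, u) = \<Theta> ?w"
    proof -
      have le: "\<eta>0 - \<delta> \<le> \<eta>0 + \<delta>" using \<delta> by simp
      from \<open>s y < 0\<close> consider "\<Theta> (y, \<eta>0 - \<delta>) \<le> \<Theta> ?w" "\<Theta> ?w \<le> \<Theta> (y, \<eta>0 + \<delta>)"
        | "\<Theta> (y, \<eta>0 + \<delta>) \<le> \<Theta> ?w" "\<Theta> ?w \<le> \<Theta> (y, \<eta>0 - \<delta>)"
        unfolding s_def mult_less_0_iff by force
      then show ?thesis
      proof cases
        case 1 then show ?thesis using IVT'[OF 1 le fc[OF yd(1)]] by auto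
      next
        case 2 then show ?thesis using IVT2'[OF 2 le fc[OF yd(1)]] by auto
      qed
    qed
    then obtain u where u: "u \<in> ?I" "\<Theta> (y, u) = \<Theta> ?w" by blast
    have W3: "(y, u) \<in> W" "(y, \<eta>) \<in> W" using inW yd(1) u eI by auto
    have lu: "\<bar>u - \<eta>0\<bar> \<le> C * norm (y - y0)" using lip[OF W(2) W3(1)] u by simp
    have leg1: "\<bar>A (y, u) - A ?w - P ?w * (u - \<eta>0) - l (y - y0)\<bar> \<le> C * (norm (y - y0))\<^sup>2"
      using base[OF W3(1)] u by simp
    have leg2: "\<bar>A (y, \<eta>) - A (y, u) - P ?w * (\<eta> - u)\<bar> \<le> \<epsilon> * \<bar>\<eta> - u\<bar>"
      by (rule increment_bound_of_quadratic_error[where A="\<lambda>\<eta>. A (y, \<eta>)" and P="\<lambda>\<eta>. P (y, \<eta>)",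
            OF fc[OF yd(1)] fi[OF yd(1)] _ _ u(1) eI, where C=C])
        (use fibre inW[OF yd(1)] Pnear[OF yd(1)] in auto)
    let ?N = "norm (w - ?w)"
    have "\<bar>A (y, \<eta>) - A ?w - (l (y - y0) + P ?w * (\<eta> - \<eta>0))\<bar> \<le> C * (norm (y - y0))\<^sup>2 + \<epsilon> * \<bar>\<eta> - u\<bar>"
    proof -
      have "A (y, \<eta>) - A ?w - (l (y - y0) + P ?w * (\<eta> - \<eta>0)) =
         (A (y, u) - A ?w - P ?w * (u - \<eta>0) - l (y - y0)) + (A (y, \<eta>) - A (y, u) - P ?w * (\<eta> - u))"
        by (simp add: algebra_simps)
      then show ?thesis using leg1 leg2 by linarith
    qed
    also have "C * (norm (y - y0))\<^sup>2 \<le> C * (e / (2 * (C + 1)) * ?N)"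
      unfolding power2_eq_square using C ny ye e by (intro mult_left_mono mult_mono) auto
    also have "C * (e / (2 * (C + 1)) * ?N) \<le> e / 2 * ?N"
    proof -
      have "C * (e / (2 * (C + 1))) \<le> e / 2" using C e by (simp add: field_simps)
      then show ?thesis using mult_right_mono[of _ _ ?N] by (metis mult.assoc norm_ge_zero)
    qed
    also have "\<epsilon> * \<bar>\<eta> - u\<bar> \<le> \<epsilon> * ((C + 1) * ?N)"
    proof (intro mult_left_mono)
      have "\<bar>\<eta> - u\<bar> \<le> ?N + C * norm (y - y0)" using ny lu by linarith
      also have "\<dots> \<le> ?N + C * ?N" using ny C by (intro add_left_mono mult_left_mono)
      finally show "\<bar>\<eta> - u\<bar> \<le> (C + 1) * ?N" by (simp add: algebra_simps)
    qed (use \<epsilon> in simp)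
    also have "\<epsilon> * ((C + 1) * ?N) = e / 2 * ?N" using C by (simp add: \<epsilon>_def divide_simps)
    finally show ?thesis unfolding w by simp
  qed
  then show "\<exists>d>0. \<forall>w. norm (w - ?w) < d \<longrightarrow>
      norm (A w - A ?w - (case w - ?w of (dy, d\<eta>) \<Rightarrow> l dy + P ?w * d\<eta>)) \<le> e * norm (w - ?w)"
    using d by blast
qed

section \<open>The potential and its force\<close>

text \<open>
  Here \<open>g\<close> stands for the derivative of \<open>f\<close>, so that the last estimate is Taylor's.
\<close>
definition second_order_bound :: "real set \<Rightarrow> (real \<Rightarrow> real) \<Rightarrow> (real \<Rightarrow> real) \<Rightarrow> real \<Rightarrow> bool" where
  "second_order_bound S f g K \<longleftrightarrow> 0 \<le> K \<and>
     (\<forall>x\<in>S. \<bar>f x\<bar> \<le> K \<and> \<bar>g x\<bar> \<le> K) \<and>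
     (\<forall>x\<in>S. \<forall>y\<in>S. \<bar>f y - f x\<bar> \<le> K * \<bar>y - x\<bar> \<and> \<bar>g y - g x\<bar> \<le> K * \<bar>y - x\<bar> \<and>
        \<bar>f y - f x - g x * (y - x)\<bar> \<le> K * (y - x)\<^sup>2)"

lemma second_order_bound_on_compact:
  fixes f g k :: "real \<Rightarrow> real"
  assumes f: "\<And>x. x \<in> {m..M} \<Longrightarrow> (f has_real_derivative g x) (at x)"
    and g: "\<And>x. x \<in> {m..M} \<Longrightarrow> (g has_real_derivative k x) (at x)"
    and k: "continuous_on {m..M} k"
  shows "\<exists>K. second_order_bound {m..M} f g K"
proof -
  have cont: "continuous_on {m..M} f" "continuous_on {m..M} g"
    using f g by (meson DERIV_isCont continuous_at_imp_continuous_on)+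
  have bd: "\<exists>K. \<forall>x\<in>{m..M}. \<bar>u x\<bar> \<le> K" if "continuous_on {m..M} u" for u :: "real \<Rightarrow> real"
  proof -
    have "bounded (u ` {m..M})"
      using that by (simp add: compact_continuous_image compact_imp_bounded)
    then show ?thesis by (auto simp: bounded_iff)
  qed
  obtain K1 K2 K3 where K1: "\<And>x. x \<in> {m..M} \<Longrightarrow> \<bar>f x\<bar> \<le> K1"
    and K2: "\<And>x. x \<in> {m..M} \<Longrightarrow> \<bar>g x\<bar> \<le> K2" and K3: "\<And>x. x \<in> {m..M} \<Longrightarrow> \<bar>k x\<bar> \<le> K3"
    using bd[OF cont(1)] bd[OF cont(2)] bd[OF k] by blast
  define K where "K = max 0 (max K1 (max K2 K3))"
  have K: "K \<ge> 0" "\<And>x. x \<in> {m..M} \<Longrightarrow> \<bar>f x\<bar> \<le> K" "\<And>x. x \<in> {m..M} \<Longrightarrow> \<bar>g x\<bar> \<le> K"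
    "\<And>x. x \<in> {m..M} \<Longrightarrow> \<bar>k x\<bar> \<le> K"
    using K1 K2 K3 by (fastforce simp: K_def)+
  have f': "\<And>x. x \<in> {m..M} \<Longrightarrow> (f has_real_derivative g x) (at x within {m..M})"
    and g': "\<And>x. x \<in> {m..M} \<Longrightarrow> (g has_real_derivative k x) (at x within {m..M})"
    using f g by (blast intro: has_field_derivative_at_within)+
  have Lf: "\<bar>f y - f x\<bar> \<le> K * \<bar>y - x\<bar>" if "x \<in> {m..M}" "y \<in> {m..M}" for x y
    using field_differentiable_bound[OF _ f', of K y x] that K by simp
  have Lg: "\<bar>g y - g x\<bar> \<le> K * \<bar>y - x\<bar>" if "x \<in> {m..M}" "y \<in> {m..M}" for x y
    using field_differentiable_bound[OF _ g', of K y x] that K by simp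
  have T: "\<bar>f y - f x - g x * (y - x)\<bar> \<le> K * (y - x)\<^sup>2" if xy: "x \<in> {m..M}" "y \<in> {m..M}" for x y
  proof -
    have "norm ((f y - g x * y) - (f x - g x * x)) \<le> (K * \<bar>y - x\<bar>) * norm (y - x)"
    proof (rule field_differentiable_bound[of "{min x y..max x y}" "\<lambda>z. f z - g x * z" "\<lambda>z. g z - g x"])
      fix z assume z: "z \<in> {min x y..max x y}"
      with xy have zm: "z \<in> {m..M}" by auto
      show "((\<lambda>z. f z - g x * z) has_real_derivative g z - g x) (at z within {min x y..max x y})"
        using has_field_derivative_at_within[OF f[OF zm]] by (auto intro!: derivative_eq_intros)
      have "\<bar>g z - g x\<bar> \<le> K * \<bar>z - x\<bar>" using Lg xy(1) zm by blast
      also have "\<dots> \<le> K * \<bar>y - x\<bar>" using z K(1) by (intro mult_left_mono) auto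
      finally show "norm (g z - g x) \<le> K * \<bar>y - x\<bar>" by simp
    qed auto
    then show ?thesis by (simp add: algebra_simps power2_eq_square flip: abs_mult)
  qed
  show ?thesis unfolding second_order_bound_def using K Lf Lg T by blast
qed

text \<open>
  With \<open>p\<close> and \<open>q\<close> for the conserved momenta \<open>\<psi>1\<close> and \<open>\<psi>2\<close>, the Hamiltonian is
  \<open>2 * \<theta>\<^sup>2 + potential p q \<eta>\<close>, and \<open>\<eta>\<close> moves in one dimension under the force
  \<open>force p q \<eta>\<close>, minus the derivative of the potential.
\<close>
definition force :: "real \<Rightarrow> real \<Rightarrow> real \<Rightarrow> real" where
  "force p q x = - p\<^sup>2 * (tan x / (cos x)\<^sup>2) + q\<^sup>2 * (cot x / (sin x)\<^sup>2)"

definition potential :: "real \<Rightarrow> real \<Rightarrow> real \<Rightarrow> real" where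
  "potential p q x = (p\<^sup>2 * (tan x)\<^sup>2 + q\<^sup>2 * (cot x)\<^sup>2) / 2 + p * q"

lemma sin_cos_pos_quadrant:
  fixes x :: real
  assumes "x \<in> {0<..<pi/2}"
  shows "sin x > 0" "cos x > 0"
  using assms by (auto intro: sin_gt_zero cos_gt_zero)

lemma has_derivative_tan_squared:
  fixes x :: real
  assumes "x \<in> {0<..<pi/2}"
  shows "((\<lambda>x. (tan x)\<^sup>2) has_real_derivative 2 * (tan x / (cos x)\<^sup>2)) (at x)"
  using sin_cos_pos_quadrant[OF assms] by (auto intro!: derivative_eq_intros simp: field_simps)

lemma has_derivative_cot_squared:
  fixes x :: real
  assumes "x \<in> {0<..<pi/2}"
  shows "((\<lambda>x. (cot x)\<^sup>2) has_real_derivative - 2 * (cot x / (sin x)\<^sup>2)) (at x)"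
  using sin_cos_pos_quadrant[OF assms]
  by (auto intro!: derivative_eq_intros DERIV_chain2[OF DERIV_cot] simp: field_simps)

lemma potential_has_derivative:
  assumes "x \<in> {0<..<pi/2}"
  shows "(potential p q has_real_derivative - force p q x) (at x)"
proof -
  have "((\<lambda>x. (p\<^sup>2 * (tan x)\<^sup>2 + q\<^sup>2 * (cot x)\<^sup>2) / 2 + p * q) has_real_derivative
      (p\<^sup>2 * (2 * (tan x / (cos x)\<^sup>2)) + q\<^sup>2 * (- 2 * (cot x / (sin x)\<^sup>2))) / 2 + 0) (at x)"
    by (intro DERIV_add DERIV_cdivide DERIV_cmult has_derivative_tan_squared
        has_derivative_cot_squared assms DERIV_const)
  then show ?thesis by (simp add: potential_def[abs_def] force_def diff_divide_distrib)
qed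

lemma tan_cot_bounds:
  assumes "0 < m" "M < pi/2"
  shows "\<exists>K. second_order_bound {m..M} (\<lambda>x. (tan x)\<^sup>2) (\<lambda>x. 2 * (tan x / (cos x)\<^sup>2)) K \<and>
             second_order_bound {m..M} (\<lambda>x. (cot x)\<^sup>2) (\<lambda>x. - 2 * (cot x / (sin x)\<^sup>2)) K"
proof -
  have quad: "x \<in> {0<..<pi/2}" if "x \<in> {m..M}" for x
    using that assms by auto
  have pos: "sin x \<noteq> 0" "cos x \<noteq> 0" if "x \<in> {m..M}" for x
    using sin_cos_pos_quadrant[OF quad[OF that]] by auto
  have "\<exists>K. second_order_bound {m..M} (\<lambda>x. (tan x)\<^sup>2) (\<lambda>x. 2 * (tan x / (cos x)\<^sup>2)) K"
  proof (rule second_order_bound_on_compact)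
    show "((\<lambda>x. 2 * (tan x / (cos x)\<^sup>2)) has_real_derivative
        2 / cos x ^ 4 + 4 * tan x * sin x / cos x ^ 3) (at x)" if "x \<in> {m..M}" for x
      using pos[OF that]
      by (auto intro!: derivative_eq_intros simp: divide_simps) (simp add: algebra_simps eval_nat_numeral)
    show "continuous_on {m..M} (\<lambda>x. 2 / cos x ^ 4 + 4 * tan x * sin x / cos x ^ 3)"
      using pos by (intro continuous_intros ballI) (fastforce)+
  qed (use has_derivative_tan_squared quad in blast)
  moreover have "\<exists>K. second_order_bound {m..M} (\<lambda>x. (cot x)\<^sup>2) (\<lambda>x. - 2 * (cot x / (sin x)\<^sup>2)) K"
  proof (rule second_order_bound_on_compact)
    show "((\<lambda>x. - 2 * (cot x / (sin x)\<^sup>2)) has_real_derivative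
        2 / sin x ^ 2 + 6 * cos x ^ 2 / sin x ^ 4) (at x)" if "x \<in> {m..M}" for x
      using pos[OF that] unfolding cot_def
      by (auto intro!: derivative_eq_intros simp: divide_simps) (simp add: algebra_simps eval_nat_numeral)
    show "continuous_on {m..M} (\<lambda>x. 2 / sin x ^ 2 + 6 * cos x ^ 2 / sin x ^ 4)"
      using pos by (intro continuous_intros ballI) (fastforce)+
  qed (use has_derivative_cot_squared quad in blast)
  ultimately obtain K1 K2 where
    *: "second_order_bound {m..M} (\<lambda>x. (tan x)\<^sup>2) (\<lambda>x. 2 * (tan x / (cos x)\<^sup>2)) K1"
      "second_order_bound {m..M} (\<lambda>x. (cot x)\<^sup>2) (\<lambda>x. - 2 * (cot x / (sin x)\<^sup>2)) K2"
    by blast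
  have mono: "second_order_bound S f g K'" if "second_order_bound S f g K" "K \<le> K'" for S f g K K'
    unfolding second_order_bound_def
    using that order_trans[OF _ mult_right_mono[OF that(2) abs_ge_zero]]
      order_trans[OF _ mult_right_mono[OF that(2) zero_le_power2]]
    unfolding second_order_bound_def by (meson order_trans)
  show ?thesis
    using mono[OF *(1), of "max K1 K2"] mono[OF *(2), of "max K1 K2"] by auto
qed

lemma half_square_times_expansion:
  fixes p p' a a' g x y K B :: real
  assumes "\<bar>a'\<bar> \<le> K" "\<bar>a' - a\<bar> \<le> K * \<bar>y - x\<bar>" "\<bar>a' - a - g * (y - x)\<bar> \<le> K * (y - x)\<^sup>2"
    and "\<bar>p\<bar> \<le> B" "0 \<le> K"
  shows "\<bar>p'\<^sup>2 * a' / 2 - p\<^sup>2 * a / 2 - p\<^sup>2 * g / 2 * (y - x) - p * a * (p' - p)\<bar>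
           \<le> K * (B\<^sup>2 + B + 1) * ((y - x)\<^sup>2 + (p' - p)\<^sup>2)"
proof -
  have B: "0 \<le> B" using assms(4) by linarith
  have eq: "p'\<^sup>2 * a' / 2 - p\<^sup>2 * a / 2 - p\<^sup>2 * g / 2 * (y - x) - p * a * (p' - p)
      = p\<^sup>2 / 2 * (a' - a - g * (y - x)) + p * (p' - p) * (a' - a) + (p' - p)\<^sup>2 / 2 * a'"
    by (simp add: field_simps power2_eq_square)
  have p2: "p\<^sup>2 \<le> B\<^sup>2" using power_mono[OF assms(4), of 2] by simp
  have "\<bar>p\<^sup>2 / 2 * (a' - a - g * (y - x))\<bar> \<le> B\<^sup>2 * (K * (y - x)\<^sup>2)"
    unfolding abs_mult using p2 assms(3) zero_le_power2[of B] zero_le_power2[of p]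
    by (intro mult_mono) (linarith | simp)+
  moreover have "\<bar>p * (p' - p) * (a' - a)\<bar> \<le> B * (K * ((y - x)\<^sup>2 + (p' - p)\<^sup>2))"
  proof -
    have 1: "\<bar>p' - p\<bar> * \<bar>y - x\<bar> \<le> (y - x)\<^sup>2 + (p' - p)\<^sup>2"
      using sum_squares_bound[of "\<bar>p' - p\<bar>" "\<bar>y - x\<bar>"]
        mult_nonneg_nonneg[OF abs_ge_zero[of "p' - p"] abs_ge_zero[of "y - x"]]
      unfolding power2_abs by linarith
    have "\<bar>p * (p' - p) * (a' - a)\<bar> = \<bar>p\<bar> * (\<bar>p' - p\<bar> * \<bar>a' - a\<bar>)"
      by (simp add: abs_mult)
    also have "\<dots> \<le> B * (\<bar>p' - p\<bar> * (K * \<bar>y - x\<bar>))"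
      using assms B by (intro mult_mono) auto
    also have "\<dots> = B * (K * (\<bar>p' - p\<bar> * \<bar>y - x\<bar>))" by simp
    also have "\<dots> \<le> B * (K * ((y - x)\<^sup>2 + (p' - p)\<^sup>2))"
      using 1 B assms(5) by (intro mult_left_mono) auto
    finally show ?thesis .
  qed
  moreover have "\<bar>(p' - p)\<^sup>2 / 2 * a'\<bar> \<le> (p' - p)\<^sup>2 * K"
    unfolding abs_mult using assms(1) by (intro mult_mono) auto
  moreover have "K * (B\<^sup>2 + B + 1) * ((y - x)\<^sup>2 + (p' - p)\<^sup>2) =
     B\<^sup>2 * (K * (y - x)\<^sup>2) + B * (K * ((y - x)\<^sup>2 + (p' - p)\<^sup>2)) + (p' - p)\<^sup>2 * K
     + (K * (y-x)\<^sup>2 + B\<^sup>2 * (K * (p' - p)\<^sup>2))"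
    by (simp add: algebra_simps)
  moreover have "0 \<le> K * (y-x)\<^sup>2 + B\<^sup>2 * (K * (p' - p)\<^sup>2)" using assms(5) by simp
  ultimately show ?thesis unfolding eq by linarith
qed

lemma square_times_lipschitz:
  fixes p p' b b' x y K B :: real
  assumes "\<bar>b\<bar> \<le> K" "\<bar>b' - b\<bar> \<le> K * \<bar>y - x\<bar>" "\<bar>p\<bar> \<le> B" "\<bar>p'\<bar> \<le> B" "0 \<le> K"
  shows "\<bar>p'\<^sup>2 * b' - p\<^sup>2 * b\<bar> \<le> K * (B\<^sup>2 + 2 * B) * (\<bar>y - x\<bar> + \<bar>p' - p\<bar>)"
proof -
  have B: "0 \<le> B" using assms(4) by linarith
  have p2: "p'\<^sup>2 \<le> B\<^sup>2" using power_mono[OF assms(4), of 2] by simp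
  have eq: "p'\<^sup>2 * b' - p\<^sup>2 * b = p'\<^sup>2 * (b' - b) + (p' + p) * (p' - p) * b"
    by (simp add: algebra_simps power2_eq_square)
  have "\<bar>p'\<^sup>2 * (b' - b)\<bar> \<le> B\<^sup>2 * (K * \<bar>y - x\<bar>)"
    unfolding abs_mult using p2 assms(2) by (intro mult_mono) auto
  moreover have "\<bar>(p' + p) * (p' - p) * b\<bar> \<le> 2 * B * \<bar>p' - p\<bar> * K"
    unfolding abs_mult using assms B by (intro mult_mono) auto
  moreover have "K * (B\<^sup>2 + 2 * B) * (\<bar>y - x\<bar> + \<bar>p' - p\<bar>) = B\<^sup>2 * (K * \<bar>y - x\<bar>) + 2 * B * \<bar>p' - p\<bar> * K
      + (B\<^sup>2 * K * \<bar>p' - p\<bar> + 2 * B * K * \<bar>y - x\<bar>)"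
    by (simp add: algebra_simps)
  moreover have "0 \<le> B\<^sup>2 * K * \<bar>p' - p\<bar> + 2 * B * K * \<bar>y - x\<bar>" using B assms(5) by simp
  ultimately show ?thesis unfolding eq by linarith
qed

text \<open>
  The partial derivatives of the potential in \<open>p\<close> and \<open>q\<close> are the angular velocities
  \<open>p * tan\<^sup>2 \<eta> + q\<close> and \<open>q * cot\<^sup>2 \<eta> + p\<close>; the second estimate is therefore the Taylor
  expansion of the potential to first order in all three variables.
\<close>
lemma potential_bounds:
  assumes "0 < m" "M < pi/2" "0 \<le> B"
  shows "\<exists>K\<ge>0.
    (\<forall>p q p' q' x y. x \<in> {m..M} \<longrightarrow> y \<in> {m..M} \<longrightarrow>
           \<bar>p\<bar> \<le> B \<longrightarrow> \<bar>q\<bar> \<le> B \<longrightarrow> \<bar>p'\<bar> \<le> B \<longrightarrow> \<bar>q'\<bar> \<le> B \<longrightarrow>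
           \<bar>force p' q' y - force p q x\<bar> \<le> K * (\<bar>y - x\<bar> + \<bar>p' - p\<bar> + \<bar>q' - q\<bar>)) \<and>
    (\<forall>p q p' q' x y. x \<in> {m..M} \<longrightarrow> y \<in> {m..M} \<longrightarrow>
           \<bar>p\<bar> \<le> B \<longrightarrow> \<bar>q\<bar> \<le> B \<longrightarrow> \<bar>p'\<bar> \<le> B \<longrightarrow> \<bar>q'\<bar> \<le> B \<longrightarrow>
           \<bar>potential p' q' y - potential p q x + force p q x * (y - x)
             - (p * (tan x)\<^sup>2 + q) * (p' - p) - (q * (cot x)\<^sup>2 + p) * (q' - q)\<bar>
             \<le> K * ((y - x)\<^sup>2 + (p' - p)\<^sup>2 + (q' - q)\<^sup>2))"
proof -
  obtain K where K1: "second_order_bound {m..M} (\<lambda>x. (tan x)\<^sup>2) (\<lambda>x. 2 * (tan x / (cos x)\<^sup>2)) K"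
    and K2: "second_order_bound {m..M} (\<lambda>x. (cot x)\<^sup>2) (\<lambda>x. - 2 * (cot x / (sin x)\<^sup>2)) K"
    using tan_cot_bounds[OF assms(1,2)] by blast
  note b1 = K1[unfolded second_order_bound_def] and b2 = K2[unfolded second_order_bound_def]
  have K0: "0 \<le> K" using b1 by blast
  define L where "L = K * (B\<^sup>2 + 2 * B + 1) * 2 + 1"
  show ?thesis
  proof (intro exI[of _ L] conjI allI impI)
    show "0 \<le> L" using K0 assms(3) by (simp add: L_def)
    fix p q p' q' x y
    assume x: "x \<in> {m..M}" and y: "y \<in> {m..M}"
      and pq: "\<bar>p\<bar> \<le> B" "\<bar>q\<bar> \<le> B" "\<bar>p'\<bar> \<le> B" "\<bar>q'\<bar> \<le> B"
    have u: "\<bar>p'\<^sup>2 * (2 * (tan y / (cos y)\<^sup>2)) - p\<^sup>2 * (2 * (tan x / (cos x)\<^sup>2))\<bar>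
        \<le> K * (B\<^sup>2 + 2 * B) * (\<bar>y - x\<bar> + \<bar>p' - p\<bar>)" (is "\<bar>?u\<bar> \<le> ?U")
      using b1 x y pq by (intro square_times_lipschitz) auto
    have v: "\<bar>q'\<^sup>2 * (- 2 * (cot y / (sin y)\<^sup>2)) - q\<^sup>2 * (- 2 * (cot x / (sin x)\<^sup>2))\<bar>
        \<le> K * (B\<^sup>2 + 2 * B) * (\<bar>y - x\<bar> + \<bar>q' - q\<bar>)" (is "\<bar>?v\<bar> \<le> ?V")
      using b2[THEN conjunct2] K0 x y pq by (intro square_times_lipschitz) blast+
    have eq: "force p' q' y - force p q x = - (?u / 2) - ?v / 2"
      by (simp add: force_def algebra_simps diff_divide_distrib)
    have UV: "K * (B\<^sup>2 + 2 * B) * (\<bar>y - x\<bar> + \<bar>p' - p\<bar>) + K * (B\<^sup>2 + 2 * B) * (\<bar>y - x\<bar> + \<bar>q' - q\<bar>)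
       \<le> L * (\<bar>y - x\<bar> + \<bar>p' - p\<bar> + \<bar>q' - q\<bar>)"
    proof -
      have "K * (B\<^sup>2 + 2 * B) * (\<bar>y - x\<bar> + \<bar>p' - p\<bar>) + K * (B\<^sup>2 + 2 * B) * (\<bar>y - x\<bar> + \<bar>q' - q\<bar>)
         \<le> (K * (B\<^sup>2 + 2 * B) * 2) * (\<bar>y - x\<bar> + \<bar>p' - p\<bar> + \<bar>q' - q\<bar>)"
        using K0 assms(3) by (simp add: algebra_simps)
      also have "\<dots> \<le> L * (\<bar>y - x\<bar> + \<bar>p' - p\<bar> + \<bar>q' - q\<bar>)"
        using K0 by (intro mult_right_mono) (auto simp: L_def algebra_simps)
      finally show ?thesis .
    qed
    have sum: "\<bar>- (u / 2) - v / 2\<bar> \<le> W" if "\<bar>u\<bar> \<le> U" "\<bar>v\<bar> \<le> V" "U + V \<le> W"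
      for u v U V W :: real
      using that by linarith
    show "\<bar>force p' q' y - force p q x\<bar> \<le> L * (\<bar>y - x\<bar> + \<bar>p' - p\<bar> + \<bar>q' - q\<bar>)"
      unfolding eq by (rule sum[OF u v UV])
    have u: "\<bar>p'\<^sup>2 * (tan y)\<^sup>2 / 2 - p\<^sup>2 * (tan x)\<^sup>2 / 2 - p\<^sup>2 * (2 * (tan x / (cos x)\<^sup>2)) / 2 * (y - x)
        - p * (tan x)\<^sup>2 * (p' - p)\<bar> \<le> K * (B\<^sup>2 + B + 1) * ((y - x)\<^sup>2 + (p' - p)\<^sup>2)" (is "\<bar>?u\<bar> \<le> ?U")
      using b1[THEN conjunct2] K0 x y pq by (intro half_square_times_expansion) blast+
    have v: "\<bar>q'\<^sup>2 * (cot y)\<^sup>2 / 2 - q\<^sup>2 * (cot x)\<^sup>2 / 2 - q\<^sup>2 * (- 2 * (cot x / (sin x)\<^sup>2)) / 2 * (y - x)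
        - q * (cot x)\<^sup>2 * (q' - q)\<bar> \<le> K * (B\<^sup>2 + B + 1) * ((y - x)\<^sup>2 + (q' - q)\<^sup>2)" (is "\<bar>?v\<bar> \<le> ?V")
      using b2[THEN conjunct2] K0 x y pq by (intro half_square_times_expansion) blast+
    have w: "\<bar>(p' - p) * (q' - q)\<bar> \<le> (p' - p)\<^sup>2 + (q' - q)\<^sup>2"
      using sum_squares_bound[of "\<bar>p' - p\<bar>" "\<bar>q' - q\<bar>"]
        mult_nonneg_nonneg[OF abs_ge_zero[of "p' - p"] abs_ge_zero[of "q' - q"]]
      unfolding power2_abs abs_mult by linarith
    have eq: "potential p' q' y - potential p q x + force p q x * (y - x)
             - (p * (tan x)\<^sup>2 + q) * (p' - p) - (q * (cot x)\<^sup>2 + p) * (q' - q)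
        = ?u + ?v + (p' - p) * (q' - q)"
      unfolding potential_def force_def by (simp add: algebra_simps add_divide_distrib)
    have UV: "?U + ?V + ((p' - p)\<^sup>2 + (q' - q)\<^sup>2) \<le> L * ((y - x)\<^sup>2 + (p' - p)\<^sup>2 + (q' - q)\<^sup>2)"
    proof -
      have "?U + ?V + ((p' - p)\<^sup>2 + (q' - q)\<^sup>2)
         \<le> (K * (B\<^sup>2 + B + 1) * 2 + 1) * ((y - x)\<^sup>2 + (p' - p)\<^sup>2 + (q' - q)\<^sup>2)"
        using K0 assms(3) by (simp add: algebra_simps)
      also have "\<dots> \<le> L * ((y - x)\<^sup>2 + (p' - p)\<^sup>2 + (q' - q)\<^sup>2)"
        using K0 assms(3) by (intro mult_right_mono) (auto simp: L_def algebra_simps)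
      finally show ?thesis .
    qed
    have sum: "\<bar>u + v + w\<bar> \<le> X" if "\<bar>u\<bar> \<le> U" "\<bar>v\<bar> \<le> V" "\<bar>w\<bar> \<le> W" "U + V + W \<le> X"
      for u v w U V W X :: real
      using that by linarith
    show "\<bar>potential p' q' y - potential p q x + force p q x * (y - x)
             - (p * (tan x)\<^sup>2 + q) * (p' - p) - (q * (cot x)\<^sup>2 + p) * (q' - q)\<bar>
             \<le> L * ((y - x)\<^sup>2 + (p' - p)\<^sup>2 + (q' - q)\<^sup>2)"
      unfolding eq by (rule sum[OF u v w UV])
  qed
qed

section \<open>Trajectories and their dependence on initial data\<close>

text \<open>
  The angles are cyclic, so that the motion of \<open>(\<eta>, \<theta>)\<close> decouples from them and the momenta enter
  as the constants \<open>p\<close> and \<open>q\<close>.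
\<close>
definition reduced_trajectory ::
  "real \<Rightarrow> real \<Rightarrow> real \<Rightarrow> (real \<Rightarrow> real) \<Rightarrow> (real \<Rightarrow> real) \<Rightarrow> bool" where
  "reduced_trajectory T p q h \<theta> \<longleftrightarrow>
     (\<forall>s\<in>{0..T}. h s \<in> {0<..<pi/2} \<and>
        (h has_real_derivative 4 * \<theta> s) (at s within {0..T}) \<and>
        (\<theta> has_real_derivative force p q (h s)) (at s within {0..T}))"

text \<open>
  The integrand is the Lagrangian \<open>\<theta> * \<eta>' - H\<close> with \<open>\<eta>' = 4 * \<theta>\<close> inserted.
\<close>
definition reduced_action :: "real \<Rightarrow> real \<Rightarrow> (real \<Rightarrow> real) \<Rightarrow> (real \<Rightarrow> real) \<Rightarrow> real" where
  "reduced_action p q h \<theta> = integral {0..1} (\<lambda>s. 2 * (\<theta> s)\<^sup>2 - potential p q (h s))"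

lemma reduced_trajectoryD:
  assumes "reduced_trajectory T p q h \<theta>" "s \<in> {0..T}"
  shows "h s \<in> {0<..<pi/2}" "(h has_real_derivative 4 * \<theta> s) (at s within {0..T})"
    "(\<theta> has_real_derivative force p q (h s)) (at s within {0..T})"
  using assms unfolding reduced_trajectory_def by blast+

lemma reduced_trajectory_restrict:
  assumes "reduced_trajectory T p q h \<theta>" "T' \<le> T"
  shows "reduced_trajectory T' p q h \<theta>"
  using assms unfolding reduced_trajectory_def
  by (auto intro: has_field_derivative_subset[where s="{0..T}"])

lemma reduced_trajectory_continuous:
  assumes "reduced_trajectory T p q h \<theta>"
  shows "continuous_on {0..T} h" "continuous_on {0..T} \<theta>"
  by (rule DERIV_continuous_on, erule reduced_trajectoryD(2)[OF assms])
    (rule DERIV_continuous_on, erule reduced_trajectoryD(3)[OF assms])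

lemma gronwall:
  fixes e e' :: "real \<Rightarrow> real"
  assumes d: "\<And>s. s \<in> {0..T} \<Longrightarrow> (e has_real_derivative e' s) (at s within {0..T})"
    and le: "\<And>s. s \<in> {0..T} \<Longrightarrow> e' s \<le> c * (e s + n)"
    and s: "s \<in> {0..T}"
  shows "e s + n \<le> (e 0 + n) * exp (c * s)"
proof -
  define w where "w = (\<lambda>s. (e s + n) * exp (- (c * s)))"
  have "w s \<le> w 0"
  proof (rule DERIV_nonpos_imp_decreasing_open[of 0 s w])
    fix x assume x: "0 < x" "x < s"
    then have xT: "x \<in> {0..T}" using s by auto
    have "(e has_real_derivative e' x) (at x)"
      using d[OF xT] x s by (simp add: at_within_Icc_at)
    then have "(w has_real_derivative (e' x - c * (e x + n)) * exp (- (c * x))) (at x)"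
      unfolding w_def by (auto intro!: derivative_eq_intros simp: algebra_simps)
    moreover have "(e' x - c * (e x + n)) * exp (- (c * x)) \<le> 0"
      using le[OF xT] by (simp add: mult_le_0_iff)
    ultimately show "\<exists>y. (w has_real_derivative y) (at x) \<and> y \<le> 0" by blast
  next
    show "continuous_on {0..s} w"
      unfolding w_def
      using continuous_on_subset[OF DERIV_continuous_on[OF d], of "{0..s}"] s
      by (auto intro!: continuous_intros)
  qed (use s in simp)
  then show ?thesis by (simp add: w_def exp_minus field_simps)
qed

definition initial_gap ::
  "real \<Rightarrow> real \<Rightarrow> (real \<Rightarrow> real) \<Rightarrow> (real \<Rightarrow> real) \<Rightarrow>
   real \<Rightarrow> real \<Rightarrow> (real \<Rightarrow> real) \<Rightarrow> (real \<Rightarrow> real) \<Rightarrow> real" where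
  "initial_gap p q h \<theta> p' q' h' \<theta>' =
     (h' 0 - h 0)\<^sup>2 + (\<theta>' 0 - \<theta> 0)\<^sup>2 + (p' - p)\<^sup>2 + (q' - q)\<^sup>2"

text \<open>
  Lipschitz dependence on the momenta and on the initial data, uniformly over all trajectories
  that stay in a compact range of \<open>\<eta>\<close>. The range is needed because the force may be
  unbounded near the two ends of the quadrant. Arbitrary durations \<open>T \<le> 1\<close> are covered
  so that the estimate applies up to the time at which a trajectory might leave the range.
\<close>
lemma trajectory_gap_bound:
  assumes "0 < m" "M < pi/2" "0 \<le> B"
  shows "\<exists>C\<ge>1. \<forall>T p q h \<theta> p' q' h' \<theta>' s. T \<le> 1 \<longrightarrow>
     reduced_trajectory T p q h \<theta> \<longrightarrow> reduced_trajectory T p' q' h' \<theta>' \<longrightarrow>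
     h ` {0..T} \<subseteq> {m..M} \<longrightarrow> h' ` {0..T} \<subseteq> {m..M} \<longrightarrow>
     \<bar>p\<bar> \<le> B \<longrightarrow> \<bar>q\<bar> \<le> B \<longrightarrow> \<bar>p'\<bar> \<le> B \<longrightarrow> \<bar>q'\<bar> \<le> B \<longrightarrow> s \<in> {0..T} \<longrightarrow>
     (h' s - h s)\<^sup>2 + (\<theta>' s - \<theta> s)\<^sup>2 \<le> C * initial_gap p q h \<theta> p' q' h' \<theta>'"
proof -
  obtain K where K: "0 \<le> K" and F: "\<forall>p q p' q' x y. x \<in> {m..M} \<longrightarrow> y \<in> {m..M} \<longrightarrow>
           \<bar>p\<bar> \<le> B \<longrightarrow> \<bar>q\<bar> \<le> B \<longrightarrow> \<bar>p'\<bar> \<le> B \<longrightarrow> \<bar>q'\<bar> \<le> B \<longrightarrow>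
           \<bar>force p' q' y - force p q x\<bar> \<le> K * (\<bar>y - x\<bar> + \<bar>p' - p\<bar> + \<bar>q' - q\<bar>)"
    using potential_bounds[OF assms] by (elim exE conjE) (rule that)
  define c where "c = 4 + 3 * K"
  show ?thesis
  proof (intro exI[of _ "exp c"] conjI allI impI)
    show "1 \<le> exp c" using K by (simp add: c_def)
    fix T p q h \<theta> p' q' h' \<theta>' s
    assume T: "T \<le> 1" and tr: "reduced_trajectory T p q h \<theta>" and tr': "reduced_trajectory T p' q' h' \<theta>'"
      and hr: "h ` {0..T} \<subseteq> {m..M}" "h' ` {0..T} \<subseteq> {m..M}"
      and pq: "\<bar>p\<bar> \<le> B" "\<bar>q\<bar> \<le> B" "\<bar>p'\<bar> \<le> B" "\<bar>q'\<bar> \<le> B" and s: "s \<in> {0..T}"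
    define e where "e = (\<lambda>s. (h' s - h s)\<^sup>2 + (\<theta>' s - \<theta> s)\<^sup>2)"
    define e' where "e' = (\<lambda>s. 2 * (h' s - h s) * (4 * \<theta>' s - 4 * \<theta> s)
        + 2 * (\<theta>' s - \<theta> s) * (force p' q' (h' s) - force p q (h s)))"
    define n where "n = (p' - p)\<^sup>2 + (q' - q)\<^sup>2"
    have "e s + n \<le> (e 0 + n) * exp (c * s)"
    proof (rule gronwall[OF _ _ s])
      fix x assume x: "x \<in> {0..T}"
      show "(e has_real_derivative e' x) (at x within {0..T})"
        unfolding e_def e'_def
        using reduced_trajectoryD(2,3)[OF tr x] reduced_trajectoryD(2,3)[OF tr' x]
        by (auto intro!: derivative_eq_intros simp: algebra_simps)
      have sq: "2 * (a * b) \<le> a\<^sup>2 + b\<^sup>2" for a b :: real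
        using sum_squares_bound[of a b] by (simp add: mult.assoc)
      have sum3: "X + Y + Z \<le> 3 * (a + b + (c + d))"
        if "X \<le> b + a" "Y \<le> b + c" "Z \<le> b + d" "0 \<le> a" "0 \<le> c" "0 \<le> d" for X Y Z a b c d :: real
        using that unfolding distrib_left by linarith
      let ?a = "\<bar>h' x - h x\<bar>" and ?b = "\<bar>\<theta>' x - \<theta> x\<bar>"
      have "2 * (h' x - h x) * (4 * \<theta>' x - 4 * \<theta> x) \<le> 4 * e x"
        unfolding e_def using sq[of "h' x - h x" "\<theta>' x - \<theta> x"] by (simp add: algebra_simps)
      moreover have "2 * (\<theta>' x - \<theta> x) * (force p' q' (h' x) - force p q (h x)) \<le> 3 * K * (e x + n)"
      proof -
        have "2 * (\<theta>' x - \<theta> x) * (force p' q' (h' x) - force p q (h x))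
            \<le> 2 * (?b * \<bar>force p' q' (h' x) - force p q (h x)\<bar>)"
          using abs_ge_self[of "(\<theta>' x - \<theta> x) * (force p' q' (h' x) - force p q (h x))"]
          unfolding abs_mult by linarith
        also have "\<dots> \<le> 2 * (?b * (K * (?a + \<bar>p' - p\<bar> + \<bar>q' - q\<bar>)))"
          using F[rule_format, OF _ _ pq, of "h x" "h' x"] hr x by (intro mult_left_mono) (auto simp: image_subset_iff)
        also have "\<dots> = K * (2 * (?b * ?a) + 2 * (?b * \<bar>p' - p\<bar>) + 2 * (?b * \<bar>q' - q\<bar>))"
          by (simp add: algebra_simps)
        also have "\<dots> \<le> K * (3 * (e x + n))"
        proof (rule mult_left_mono[OF _ K])
          show "2 * (?b * ?a) + 2 * (?b * \<bar>p' - p\<bar>) + 2 * (?b * \<bar>q' - q\<bar>) \<le> 3 * (e x + n)"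
            using sum3[OF sq[of ?b ?a] sq[of ?b "\<bar>p' - p\<bar>"] sq[of ?b "\<bar>q' - q\<bar>"]]
            unfolding e_def n_def power2_abs by simp
        qed
        finally show ?thesis by (simp only: mult.assoc mult.left_commute)
      qed
      moreover have "0 \<le> n" by (simp add: n_def)
      ultimately show "e' x \<le> c * (e x + n)" by (simp add: e'_def c_def algebra_simps)
    qed
    also have "\<dots> \<le> (e 0 + n) * exp c"
    proof (intro mult_left_mono)
      have "c * s \<le> c * 1" using s T K by (intro mult_left_mono) (auto simp: c_def)
      then show "exp (c * s) \<le> exp c" by simp
    qed (simp add: e_def n_def)
    finally have "e s + n \<le> (e 0 + n) * exp c" .
    moreover have "0 \<le> n" by (simp add: n_def)
    ultimately have "e s \<le> exp c * (e 0 + n)" by (simp add: mult.commute)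
    then show "(h' s - h s)\<^sup>2 + (\<theta>' s - \<theta> s)\<^sup>2 \<le> exp c * initial_gap p q h \<theta> p' q' h' \<theta>'"
      by (simp add: e_def n_def initial_gap_def add.assoc)
  qed
qed

text \<open>
  If a trajectory with nearly the same data as \<open>h\<close> left the tube of radius \<open>r\<close> around
  \<open>h\<close>, then up to the first exit time both curves would lie in one compact range, and the
  preceding bound would put the second curve strictly inside the tube at that very time.
\<close>
lemma nearby_trajectories_in_compact:
  assumes tr: "reduced_trajectory 1 p q h \<theta>"
  shows "\<exists>m M B d. 0 < m \<and> M < pi/2 \<and> 0 \<le> B \<and> 0 < d \<and>
     (\<forall>p' q' h' \<theta>'. reduced_trajectory 1 p' q' h' \<theta>' \<longrightarrow> initial_gap p q h \<theta> p' q' h' \<theta>' < d \<longrightarrow>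
        h' ` {0..1} \<subseteq> {m..M} \<and> \<bar>p'\<bar> \<le> B \<and> \<bar>q'\<bar> \<le> B)"
proof -
  note ch = reduced_trajectory_continuous(1)[OF tr]
  obtain s1 s2 where s1: "s1 \<in> {0..1}" "\<And>s. s \<in> {0..1} \<Longrightarrow> h s1 \<le> h s"
    and s2: "s2 \<in> {0..1}" "\<And>s. s \<in> {0..1} \<Longrightarrow> h s \<le> h s2"
    using continuous_attains_inf[OF _ _ ch] continuous_attains_sup[OF _ _ ch] by auto
  have b: "0 < h s1" "h s2 < pi/2"
    using reduced_trajectoryD(1)[OF tr s1(1)] reduced_trajectoryD(1)[OF tr s2(1)] by auto
  define r where "r = min (h s1) (pi/2 - h s2) / 2"
  have r: "0 < r" "r < h s1" "h s2 + r < pi/2"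
    using b unfolding r_def by (auto simp: min_def field_simps)
  define m M B where "m = h s1 - r" and "M = h s2 + r" and "B = \<bar>p\<bar> + \<bar>q\<bar> + 1"
  have mM: "0 < m" "M < pi/2" "0 \<le> B" using r by (auto simp: m_def M_def B_def)
  have hm: "h ` {0..1} \<subseteq> {m..M}" using s1 s2 r by (force simp: m_def M_def)
  obtain C where C: "1 \<le> C" and gap: "\<forall>T p q h \<theta> p' q' h' \<theta>' s. T \<le> 1 \<longrightarrow>
     reduced_trajectory T p q h \<theta> \<longrightarrow> reduced_trajectory T p' q' h' \<theta>' \<longrightarrow>
     h ` {0..T} \<subseteq> {m..M} \<longrightarrow> h' ` {0..T} \<subseteq> {m..M} \<longrightarrow>
     \<bar>p\<bar> \<le> B \<longrightarrow> \<bar>q\<bar> \<le> B \<longrightarrow> \<bar>p'\<bar> \<le> B \<longrightarrow> \<bar>q'\<bar> \<le> B \<longrightarrow> s \<in> {0..T} \<longrightarrow>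
     (h' s - h s)\<^sup>2 + (\<theta>' s - \<theta> s)\<^sup>2 \<le> C * initial_gap p q h \<theta> p' q' h' \<theta>'"
    using trajectory_gap_bound[OF mM] by (elim exE conjE) (rule that)
  \<comment> \<open>The bound \<open>1\<close> keeps the momenta below \<open>B\<close>; the other one makes the distance stay below \<open>r\<close>.\<close>
  define d where "d = min 1 (r\<^sup>2 / C)"
  have d: "0 < d" "d \<le> 1" "C * d \<le> r\<^sup>2" using r C by (auto simp: d_def min_def field_simps)
  have "h' ` {0..1} \<subseteq> {m..M} \<and> \<bar>p'\<bar> \<le> B \<and> \<bar>q'\<bar> \<le> B"
    if tr': "reduced_trajectory 1 p' q' h' \<theta>'" and N: "initial_gap p q h \<theta> p' q' h' \<theta>' < d" for p' q' h' \<theta>'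
  proof -
    let ?N = "initial_gap p q h \<theta> p' q' h' \<theta>'"
    have N1: "(p' - p)\<^sup>2 \<le> ?N" "(q' - q)\<^sup>2 \<le> ?N" "(h' 0 - h 0)\<^sup>2 \<le> ?N" "0 \<le> ?N"
      by (auto simp: initial_gap_def)
    have "\<bar>p' - p\<bar> < 1" "\<bar>q' - q\<bar> < 1"
      using N1 N d(2) by (auto simp: abs_square_less_1[symmetric])
    then have pq: "\<bar>p\<bar> \<le> B" "\<bar>q\<bar> \<le> B" "\<bar>p'\<bar> \<le> B" "\<bar>q'\<bar> \<le> B" by (auto simp: B_def)
    have CN: "C * ?N < r\<^sup>2"
      using mult_strict_left_mono[OF N, of C] C d(3) by linarith
    note ch' = reduced_trajectory_continuous(1)[OF tr']
    define D where "D = (\<lambda>s. \<bar>h' s - h s\<bar>)"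
    have cD: "continuous_on {0..1} D" unfolding D_def by (intro continuous_intros ch ch')
    have D0: "D 0 < r"
    proof -
      have "?N \<le> C * ?N" using C N1(4) by (simp add: mult_le_cancel_right1)
      then have "(D 0)\<^sup>2 < r\<^sup>2" using N1(3) CN by (simp add: D_def)
      then show ?thesis using r by (meson less_imp_le power_less_imp_less_base)
    qed
    have D: "D s < r" if s: "s \<in> {0..1}" for s
    proof (rule ccontr)
      assume "\<not> D s < r"
      define S where "S = {x \<in> {0..1}. r \<le> D x}"
      have "compact S"
      proof -
        have "closed S" unfolding S_def
          using continuous_closed_preimage[OF cD closed_atLeastAtMost closed_atLeast[of r]]
          by (simp add: vimage_def Int_def)
        then show ?thesis unfolding compact_eq_bounded_closed
          by (auto simp: S_def intro: bounded_subset[OF bounded_closed_interval[of 0 1]])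
      qed
      moreover have "s \<in> S" using s \<open>\<not> D s < r\<close> by (simp add: S_def)
      ultimately obtain t where t: "t \<in> S" "\<And>x. x \<in> S \<Longrightarrow> t \<le> x"
        using compact_attains_inf[of S] by blast
      have t01: "t \<in> {0..1}" "r \<le> D t" using t by (auto simp: S_def)
      have below: "D x \<le> r" if x: "x \<in> {0..t}" for x
      proof (rule ccontr)
        assume "\<not> D x \<le> r"
        then have "x \<in> S" using x t01 by (auto simp: S_def)
        then have "x = t" using t(2) x by force
        \<comment> \<open>The distance takes the value \<open>r\<close> by time \<open>t\<close>, and by minimality it does so only at \<open>t\<close>.\<close>
        have "\<exists>y\<ge>0. y \<le> t \<and> D y = r"
          using IVT'[of D 0 r t] D0 t01 continuous_on_subset[OF cD, of "{0..t}"] by auto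
        then obtain y where y: "0 \<le> y" "y \<le> t" "D y = r" by blast
        then have "y \<in> S" using t01 by (auto simp: S_def)
        then have "y = t" using t(2) y by force
        then show False using y \<open>x = t\<close> \<open>\<not> D x \<le> r\<close> by simp
      qed
      have hm': "h' ` {0..t} \<subseteq> {m..M}"
      proof (rule image_subsetI)
        fix x assume x: "x \<in> {0..t}"
        have "h s1 \<le> h x" "h x \<le> h s2" using x s1(2) s2(2) t01 by auto
        then show "h' x \<in> {m..M}" using below[OF x] unfolding D_def m_def M_def by auto
      qed
      have "(h' t - h t)\<^sup>2 + (\<theta>' t - \<theta> t)\<^sup>2 \<le> C * ?N"
        using t01 hm hm' pq
        by (intro gap[rule_format, of t]) (auto intro: reduced_trajectory_restrict[OF tr] reduced_trajectory_restrict[OF tr'])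
      then have "(D t)\<^sup>2 < r\<^sup>2" using CN zero_le_power2[of "\<theta>' t - \<theta> t"]
        unfolding D_def power2_abs by linarith
      then have "D t < r" using r by (meson less_imp_le power_less_imp_less_base)
      then show False using t01 by simp
    qed
    have "h' ` {0..1} \<subseteq> {m..M}"
    proof (rule image_subsetI)
      fix x :: real assume x: "x \<in> {0..1}"
      have "h s1 \<le> h x" "h x \<le> h s2" using x s1(2) s2(2) by auto
      then show "h' x \<in> {m..M}" using D[OF x] unfolding D_def m_def M_def by auto
    qed
    then show ?thesis using pq by blast
  qed
  then show ?thesis
    using mM d(1) by (intro exI[of _ m] exI[of _ M] exI[of _ B] exI[of _ d] conjI allI impI) auto
qed

section \<open>The action and its first variation\<close>

lemma tan_cot_continuous_along:
  assumes "reduced_trajectory T p q h \<theta>"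
  shows "continuous_on {0..T} (\<lambda>s. (tan (h s))\<^sup>2)" "continuous_on {0..T} (\<lambda>s. (cot (h s))\<^sup>2)"
proof -
  have "sin (h s) \<noteq> 0 \<and> cos (h s) \<noteq> 0" if "s \<in> {0..T}" for s
    using sin_cos_pos_quadrant[OF reduced_trajectoryD(1)[OF assms that]] by simp
  then show "continuous_on {0..T} (\<lambda>s. (tan (h s))\<^sup>2)" "continuous_on {0..T} (\<lambda>s. (cot (h s))\<^sup>2)"
    unfolding tan_def cot_def
    by (auto intro!: continuous_intros reduced_trajectory_continuous(1)[OF assms])
qed

lemma reduced_action_has_integral:
  assumes "reduced_trajectory 1 p q h \<theta>"
  shows "((\<lambda>s. 2 * (\<theta> s)\<^sup>2 - potential p q (h s)) has_integral reduced_action p q h \<theta>) {0..1}"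
  unfolding reduced_action_def potential_def
  by (intro integrable_integral integrable_continuous_real continuous_intros
      tan_cot_continuous_along[OF assms] reduced_trajectory_continuous[OF assms]) auto

lemma angular_velocity_has_integral:
  assumes "reduced_trajectory 1 p q h \<theta>"
  shows "((\<lambda>s. c * (p * (tan (h s))\<^sup>2 + q)) has_integral
      c * integral {0..1} (\<lambda>s. p * (tan (h s))\<^sup>2 + q)) {0..1}"
    and "((\<lambda>s. c * (q * (cot (h s))\<^sup>2 + p)) has_integral
      c * integral {0..1} (\<lambda>s. q * (cot (h s))\<^sup>2 + p)) {0..1}"
  by (intro has_integral_mult_right integrable_integral integrable_continuous_real continuous_intros
      tan_cot_continuous_along[OF assms])+

text \<open>
  The linear part is \<open>\<theta> d\<eta>\<close> at the end minus \<open>\<theta> d\<eta>\<close> at the start minus the integral of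
  \<open>\<partial>H/\<partial>\<psi> d\<psi>\<close>; by Hamilton's equations the interior terms of the variation sum to the total
  derivative of \<open>\<theta> * (h' - h)\<close>. What remains of the integrand is
  \<open>2 * (\<theta>' - \<theta>)\<^sup>2\<close> minus the Taylor remainder of the potential.
\<close>
lemma first_variation:
  assumes "0 < m" "M < pi/2" "0 \<le> B"
  shows "\<exists>C\<ge>0. \<forall>p q h \<theta> p' q' h' \<theta>'.
     reduced_trajectory 1 p q h \<theta> \<longrightarrow> reduced_trajectory 1 p' q' h' \<theta>' \<longrightarrow>
     h ` {0..1} \<subseteq> {m..M} \<longrightarrow> h' ` {0..1} \<subseteq> {m..M} \<longrightarrow>
     \<bar>p\<bar> \<le> B \<longrightarrow> \<bar>q\<bar> \<le> B \<longrightarrow> \<bar>p'\<bar> \<le> B \<longrightarrow> \<bar>q'\<bar> \<le> B \<longrightarrow>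
     \<bar>reduced_action p' q' h' \<theta>' - reduced_action p q h \<theta>
        - (\<theta> 1 * (h' 1 - h 1) - \<theta> 0 * (h' 0 - h 0)
           - (p' - p) * integral {0..1} (\<lambda>s. p * (tan (h s))\<^sup>2 + q)
           - (q' - q) * integral {0..1} (\<lambda>s. q * (cot (h s))\<^sup>2 + p))\<bar>
       \<le> C * initial_gap p q h \<theta> p' q' h' \<theta>'"
proof -
  obtain K where K: "0 \<le> K" and V: "\<forall>p q p' q' x y. x \<in> {m..M} \<longrightarrow> y \<in> {m..M} \<longrightarrow>
           \<bar>p\<bar> \<le> B \<longrightarrow> \<bar>q\<bar> \<le> B \<longrightarrow> \<bar>p'\<bar> \<le> B \<longrightarrow> \<bar>q'\<bar> \<le> B \<longrightarrow>
           \<bar>potential p' q' y - potential p q x + force p q x * (y - x)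
             - (p * (tan x)\<^sup>2 + q) * (p' - p) - (q * (cot x)\<^sup>2 + p) * (q' - q)\<bar>
             \<le> K * ((y - x)\<^sup>2 + (p' - p)\<^sup>2 + (q' - q)\<^sup>2)"
    using potential_bounds[OF assms] by (elim exE conjE) (rule that)
  obtain C where C: "1 \<le> C" and gap: "\<forall>T p q h \<theta> p' q' h' \<theta>' s. T \<le> 1 \<longrightarrow>
     reduced_trajectory T p q h \<theta> \<longrightarrow> reduced_trajectory T p' q' h' \<theta>' \<longrightarrow>
     h ` {0..T} \<subseteq> {m..M} \<longrightarrow> h' ` {0..T} \<subseteq> {m..M} \<longrightarrow>
     \<bar>p\<bar> \<le> B \<longrightarrow> \<bar>q\<bar> \<le> B \<longrightarrow> \<bar>p'\<bar> \<le> B \<longrightarrow> \<bar>q'\<bar> \<le> B \<longrightarrow> s \<in> {0..T} \<longrightarrow>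
     (h' s - h s)\<^sup>2 + (\<theta>' s - \<theta> s)\<^sup>2 \<le> C * initial_gap p q h \<theta> p' q' h' \<theta>'"
    using trajectory_gap_bound[OF assms] by (elim exE conjE) (rule that)
  show ?thesis
  proof (intro exI[of _ "2 * C + K * (C + 1)"] conjI allI impI)
    show "0 \<le> 2 * C + K * (C + 1)" using C K by simp
    fix p q h \<theta> p' q' h' \<theta>'
    assume tr: "reduced_trajectory 1 p q h \<theta>" and tr': "reduced_trajectory 1 p' q' h' \<theta>'"
      and hr: "h ` {0..1} \<subseteq> {m..M}" "h' ` {0..1} \<subseteq> {m..M}"
      and pq: "\<bar>p\<bar> \<le> B" "\<bar>q\<bar> \<le> B" "\<bar>p'\<bar> \<le> B" "\<bar>q'\<bar> \<le> B"
    let ?N = "initial_gap p q h \<theta> p' q' h' \<theta>'"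
    \<comment> \<open>The boundary terms are the increment of \<open>\<theta> * (h' - h)\<close>.\<close>
    have bdry: "((\<lambda>s. force p q (h s) * (h' s - h s) + \<theta> s * (4 * \<theta>' s - 4 * \<theta> s)) has_integral
        (\<theta> 1 * (h' 1 - h 1) - \<theta> 0 * (h' 0 - h 0))) {0..1}"
    proof (rule fundamental_theorem_of_calculus)
      fix x :: real assume x: "x \<in> {0..1}"
      show "((\<lambda>s. \<theta> s * (h' s - h s)) has_vector_derivative
          force p q (h x) * (h' x - h x) + \<theta> x * (4 * \<theta>' x - 4 * \<theta> x)) (at x within {0..1})"
        unfolding has_real_derivative_iff_has_vector_derivative[symmetric]
        using reduced_trajectoryD(2,3)[OF tr x] reduced_trajectoryD(2,3)[OF tr' x]
        by (auto intro!: derivative_eq_intros)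
    qed simp
    note I = has_integral_diff[OF has_integral_diff[OF reduced_action_has_integral[OF tr'] reduced_action_has_integral[OF tr]]
        has_integral_diff[OF has_integral_diff[OF bdry angular_velocity_has_integral(1)[OF tr, of "p' - p"]]
          angular_velocity_has_integral(2)[OF tr, of "q' - q"]]]
    have "norm (reduced_action p' q' h' \<theta>' - reduced_action p q h \<theta>
        - (\<theta> 1 * (h' 1 - h 1) - \<theta> 0 * (h' 0 - h 0)
           - (p' - p) * integral {0..1} (\<lambda>s. p * (tan (h s))\<^sup>2 + q)
           - (q' - q) * integral {0..1} (\<lambda>s. q * (cot (h s))\<^sup>2 + p)))
        \<le> ((2 * C + K * (C + 1)) * ?N) * measure lborel {0..1::real}"
    proof (rule has_integral_bound_real[OF _ finite.emptyI I])
      have N0: "0 \<le> ?N" by (simp add: initial_gap_def)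
      show "0 \<le> (2 * C + K * (C + 1)) * ?N" using C K N0 by simp
      fix s :: real assume "s \<in> {0..1} - {}"
      then have s: "s \<in> {0..1}" by simp
      let ?R = "potential p' q' (h' s) - potential p q (h s) + force p q (h s) * (h' s - h s)
             - (p * (tan (h s))\<^sup>2 + q) * (p' - p) - (q * (cot (h s))\<^sup>2 + p) * (q' - q)"
      have g: "(h' s - h s)\<^sup>2 + (\<theta>' s - \<theta> s)\<^sup>2 \<le> C * ?N"
        using gap[rule_format, OF order_refl tr tr' hr pq s] .
      have "\<bar>?R\<bar> \<le> K * ((h' s - h s)\<^sup>2 + (p' - p)\<^sup>2 + (q' - q)\<^sup>2)"
        using hr s pq by (intro V[rule_format]) (auto simp: image_subset_iff)
      also have "\<dots> \<le> K * ((C + 1) * ?N)"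
      proof (rule mult_left_mono[OF _ K])
        have "(p' - p)\<^sup>2 + (q' - q)\<^sup>2 \<le> ?N" by (simp add: initial_gap_def)
        then show "(h' s - h s)\<^sup>2 + (p' - p)\<^sup>2 + (q' - q)\<^sup>2 \<le> (C + 1) * ?N"
          using g zero_le_power2[of "\<theta>' s - \<theta> s"] unfolding distrib_right by linarith
      qed
      finally have R: "\<bar>?R\<bar> \<le> K * (C + 1) * ?N" by simp
      have T: "2 * (\<theta>' s - \<theta> s)\<^sup>2 \<le> 2 * C * ?N"
        using g zero_le_power2[of "h' s - h s"] by linarith
      have eq: "2 * (\<theta>' s)\<^sup>2 - potential p' q' (h' s) - (2 * (\<theta> s)\<^sup>2 - potential p q (h s))
          - (force p q (h s) * (h' s - h s) + \<theta> s * (4 * \<theta>' s - 4 * \<theta> s)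
             - (p' - p) * (p * (tan (h s))\<^sup>2 + q) - (q' - q) * (q * (cot (h s))\<^sup>2 + p))
          = 2 * (\<theta>' s - \<theta> s)\<^sup>2 - ?R"
        by (simp add: algebra_simps power2_eq_square)
      show "norm (2 * (\<theta>' s)\<^sup>2 - potential p' q' (h' s) - (2 * (\<theta> s)\<^sup>2 - potential p q (h s))
          - (force p q (h s) * (h' s - h s) + \<theta> s * (4 * \<theta>' s - 4 * \<theta> s)
             - (p' - p) * (p * (tan (h s))\<^sup>2 + q) - (q' - q) * (q * (cot (h s))\<^sup>2 + p)))
         \<le> (2 * C + K * (C + 1)) * ?N"
        unfolding eq real_norm_def using R T zero_le_power2[of "\<theta>' s - \<theta> s"]
        by (simp only: distrib_right)
    qed
    then show "\<bar>reduced_action p' q' h' \<theta>' - reduced_action p q h \<theta>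
        - (\<theta> 1 * (h' 1 - h 1) - \<theta> 0 * (h' 0 - h 0)
           - (p' - p) * integral {0..1} (\<lambda>s. p * (tan (h s))\<^sup>2 + q)
           - (q' - q) * integral {0..1} (\<lambda>s. q * (cot (h s))\<^sup>2 + p))\<bar>
       \<le> (2 * C + K * (C + 1)) * ?N"
      by simp
  qed
qed

lemma energy_conserved:
  assumes tr: "reduced_trajectory 1 p q h \<theta>" and s: "s \<in> {0..1}"
  shows "2 * (\<theta> s)\<^sup>2 + potential p q (h s) = 2 * (\<theta> 1)\<^sup>2 + potential p q (h 1)"
proof -
  have "\<exists>c. \<forall>x\<in>{0..1}. 2 * (\<theta> x)\<^sup>2 + potential p q (h x) = c"
  proof (rule has_field_derivative_zero_constant)
    fix x :: real assume x: "x \<in> {0..1}"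
    note D = reduced_trajectoryD[OF tr x]
    have "((\<lambda>x. potential p q (h x)) has_real_derivative - force p q (h x) * (4 * \<theta> x)) (at x within {0..1})"
      by (rule DERIV_chain2[where f = "potential p q" and g = h, OF potential_has_derivative[OF D(1)] D(2)])
    then show "((\<lambda>x. 2 * (\<theta> x)\<^sup>2 + potential p q (h x)) has_real_derivative 0) (at x within {0..1})"
      using D(3) by (auto intro!: derivative_eq_intros)
  qed simp
  then obtain c where c: "\<forall>x\<in>{0..1}. 2 * (\<theta> x)\<^sup>2 + potential p q (h x) = c" ..
  show ?thesis using c[rule_format, OF s] c[rule_format, of 1] by simp
qed

text \<open>
  The energy identity behind the Hamilton--Jacobi equation: \<open>L + \<psi>1 * \<zeta>1' + \<psi>2 * \<zeta>2'\<close> with the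
  Lagrangian \<open>L = 2 * \<theta>\<^sup>2 - potential\<close> equals \<open>H\<close>, because the potential is homogeneous of degree
  two in the momenta. Since \<open>H\<close> is conserved and the duration is \<open>1\<close>, its integral is its value
  at the end.
\<close>
lemma energy_equals_action_balance:
  assumes tr: "reduced_trajectory 1 p q h \<theta>"
  shows "2 * (\<theta> 1)\<^sup>2 + potential p q (h 1)
     = reduced_action p q h \<theta> + p * integral {0..1} (\<lambda>s. p * (tan (h s))\<^sup>2 + q)
         + q * integral {0..1} (\<lambda>s. q * (cot (h s))\<^sup>2 + p)"
proof -
  have eq: "2 * (\<theta> s)\<^sup>2 - potential p q (h s) + p * (p * (tan (h s))\<^sup>2 + q) + q * (q * (cot (h s))\<^sup>2 + p)
      = 2 * (\<theta> 1)\<^sup>2 + potential p q (h 1)" if "s \<in> {0..1}" for s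
    unfolding energy_conserved[OF tr that, symmetric]
    by (simp add: potential_def power2_eq_square field_simps)
  have "((\<lambda>s. 2 * (\<theta> 1)\<^sup>2 + potential p q (h 1)) has_integral
      reduced_action p q h \<theta> + p * integral {0..1} (\<lambda>s. p * (tan (h s))\<^sup>2 + q)
         + q * integral {0..1} (\<lambda>s. q * (cot (h s))\<^sup>2 + p)) {0..1::real}"
    by (rule has_integral_eq[OF _ has_integral_add[OF has_integral_add[OF reduced_action_has_integral[OF tr]
            angular_velocity_has_integral(1)[OF tr]] angular_velocity_has_integral(2)[OF tr]]]) (rule eq)
  moreover have "((\<lambda>s. 2 * (\<theta> 1)\<^sup>2 + potential p q (h 1)) has_integral
      (2 * (\<theta> 1)\<^sup>2 + potential p q (h 1))) {0..1::real}"
    using has_integral_const_real[of "2 * (\<theta> 1)\<^sup>2 + potential p q (h 1)" 0 1] by simp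
  ultimately show ?thesis by (rule has_integral_unique[symmetric])
qed

section \<open>Differentiability of the modified action and the Hamilton--Jacobi equation\<close>

text \<open>
  The tuple \<open>(\<zeta>1, \<zeta>2, \<eta>0, \<psi>1, \<psi>2)\<close> collects the data apart from the end value \<open>\<eta>\<close>. The latter is kept
  apart because it is the coordinate of the fibres along which the selected initial momentum is
  injective.
\<close>
type_synonym boundary_data = "real \<times> real \<times> real \<times> real \<times> real"

abbreviation initial_eta :: "boundary_data \<Rightarrow> real" where
  "initial_eta y \<equiv> fst (snd (snd y))"
abbreviation psi1_of :: "boundary_data \<Rightarrow> real" where
  "psi1_of y \<equiv> fst (snd (snd (snd y)))"
abbreviation psi2_of :: "boundary_data \<Rightarrow> real" where
  "psi2_of y \<equiv> snd (snd (snd (snd y)))"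

lemma boundary_data_norm:
  fixes y :: boundary_data
  shows "\<bar>initial_eta y\<bar> \<le> norm y" "\<bar>psi1_of y\<bar> \<le> norm y" "\<bar>psi2_of y\<bar> \<le> norm y"
proof -
  obtain a b c p q where y: "y = (a, b, c, p, q)" by (cases y) auto
  have 1: "norm (c, p, q) \<le> norm y" unfolding y
    using norm_snd_le[of "(c, p, q)" b] norm_snd_le[of "(b, c, p, q)" a] by linarith
  have 2: "norm (p, q) \<le> norm y" using norm_snd_le[of "(p, q)" c] 1 by linarith
  show "\<bar>initial_eta y\<bar> \<le> norm y" using norm_fst_le[of c "(p, q)"] 1 by (simp add: y)
  show "\<bar>psi1_of y\<bar> \<le> norm y" using norm_fst_le[of p q] 2 by (simp add: y)
  show "\<bar>psi2_of y\<bar> \<le> norm y" using norm_snd_le[of q p] 2 by (simp add: y)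
qed

text \<open>
  The selected initial momentum \<open>\<Theta>\<close> plays the role of the parameter in the envelope theorem. Momenta,
  initial position and \<open>\<Theta>\<close> determine the end value \<open>\<eta>\<close> in a Lipschitz manner, and the
  first variation supplies the expansions with quadratic errors. Conjugate points, where
  \<open>\<eta>\<close> is stationary in \<open>\<Theta>\<close>, are the degenerate case.
\<close>
lemma action_branch_has_derivative:
  fixes \<Theta> :: "boundary_data \<times> real \<Rightarrow> real" and H T :: "boundary_data \<times> real \<Rightarrow> real \<Rightarrow> real"
  assumes W: "open W" "(y0, \<eta>0) \<in> W" and cont: "continuous_on W \<Theta>"
    and tr: "\<And>y \<eta>. (y, \<eta>) \<in> W \<Longrightarrow>
      reduced_trajectory 1 (psi1_of y) (psi2_of y) (H (y, \<eta>)) (T (y, \<eta>))"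
    and bc: "\<And>y \<eta>. (y, \<eta>) \<in> W \<Longrightarrow>
      H (y, \<eta>) 0 = initial_eta y \<and> H (y, \<eta>) 1 = \<eta> \<and> T (y, \<eta>) 0 = \<Theta> (y, \<eta>)"
  defines "I1 \<equiv> integral {0..1} (\<lambda>s. psi1_of y0 * (tan (H (y0, \<eta>0) s))\<^sup>2 + psi2_of y0)"
    and "I2 \<equiv> integral {0..1} (\<lambda>s. psi2_of y0 * (cot (H (y0, \<eta>0) s))\<^sup>2 + psi1_of y0)"
  shows "((\<lambda>w. reduced_action (psi1_of (fst w)) (psi2_of (fst w)) (H w) (T w)) has_derivative
      (\<lambda>(dy, d\<eta>). (- T (y0, \<eta>0) 0 * initial_eta dy - psi1_of dy * I1 - psi2_of dy * I2)
         + T (y0, \<eta>0) 1 * d\<eta>)) (at (y0, \<eta>0))"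
proof -
  let ?w0 = "(y0, \<eta>0)"
  define A where "A = (\<lambda>w. reduced_action (psi1_of (fst w)) (psi2_of (fst w)) (H w) (T w))"
  define l where "l = (\<lambda>dy. - T ?w0 0 * initial_eta dy - psi1_of dy * I1 - psi2_of dy * I2)"
  define gap where "gap = (\<lambda>w w'. initial_gap (psi1_of (fst w)) (psi2_of (fst w)) (H w) (T w)
      (psi1_of (fst w')) (psi2_of (fst w')) (H w') (T w'))"
  have gap: "gap w w' = (initial_eta (fst w') - initial_eta (fst w))\<^sup>2 + (\<Theta> w' - \<Theta> w)\<^sup>2
      + (psi1_of (fst w') - psi1_of (fst w))\<^sup>2 + (psi2_of (fst w') - psi2_of (fst w))\<^sup>2"
    if "w \<in> W" "w' \<in> W" for w w'
    using bc[of "fst w" "snd w"] bc[of "fst w'" "snd w'"] that by (simp add: gap_def initial_gap_def)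
  have gap_le: "gap w w' \<le> 3 * (norm (fst w' - fst w))\<^sup>2 + (\<Theta> w' - \<Theta> w)\<^sup>2"
    if "w \<in> W" "w' \<in> W" for w w'
  proof -
    note b = boundary_data_norm[of "fst w' - fst w", simplified]
    have sq: "x\<^sup>2 \<le> (norm (fst w' - fst w))\<^sup>2" if "\<bar>x\<bar> \<le> norm (fst w' - fst w)" for x :: real
      using power_mono[OF that, of 2] by simp
    show ?thesis unfolding gap[OF that] using sq[OF b(1)] sq[OF b(2)] sq[OF b(3)] by linarith
  qed
  obtain m M B d where mM: "0 < m" "M < pi/2" "0 \<le> B" and d: "0 < d"
    and near: "\<forall>p' q' h' \<theta>'. reduced_trajectory 1 p' q' h' \<theta>' \<longrightarrow>
        initial_gap (psi1_of y0) (psi2_of y0) (H ?w0) (T ?w0) p' q' h' \<theta>' < d \<longrightarrow>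
        h' ` {0..1} \<subseteq> {m..M} \<and> \<bar>p'\<bar> \<le> B \<and> \<bar>q'\<bar> \<le> B"
    using nearby_trajectories_in_compact[OF tr[OF W(2)]] by (elim exE conjE) (rule that)
  define W' where "W' = W \<inter> {w. (initial_eta (fst w) - initial_eta y0)\<^sup>2 + (\<Theta> w - \<Theta> ?w0)\<^sup>2
      + (psi1_of (fst w) - psi1_of y0)\<^sup>2 + (psi2_of (fst w) - psi2_of y0)\<^sup>2 < d}"
  have W': "W' \<subseteq> W" "?w0 \<in> W'" using W d by (auto simp: W'_def)
  have "continuous_on W (\<lambda>w. (initial_eta (fst w) - initial_eta y0)\<^sup>2 + (\<Theta> w - \<Theta> ?w0)\<^sup>2
      + (psi1_of (fst w) - psi1_of y0)\<^sup>2 + (psi2_of (fst w) - psi2_of y0)\<^sup>2)"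
    by (intro continuous_intros cont)
  from continuous_open_preimage[OF this W(1) open_lessThan[of d]]
  have oW': "open W'" by (simp add: W'_def vimage_def)
  have tube: "H w ` {0..1} \<subseteq> {m..M} \<and> \<bar>psi1_of (fst w)\<bar> \<le> B \<and> \<bar>psi2_of (fst w)\<bar> \<le> B" if w: "w \<in> W'" for w
  proof -
    have wW: "w \<in> W" using w W' by blast
    have "gap ?w0 w < d" unfolding gap[OF W(2) wW] using w by (simp add: W'_def)
    then show ?thesis using near[rule_format, of "psi1_of (fst w)" "psi2_of (fst w)" "H w" "T w"]
        tr[of "fst w" "snd w"] wW by (simp add: gap_def)
  qed
  have trw: "reduced_trajectory 1 (psi1_of (fst w)) (psi2_of (fst w)) (H w) (T w)" if "w \<in> W'" for w
    using tr[of "fst w" "snd w"] that W' by auto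
  obtain C1 where C1: "1 \<le> C1" and C1': "\<forall>T p q h \<theta> p' q' h' \<theta>' s. T \<le> 1 \<longrightarrow>
     reduced_trajectory T p q h \<theta> \<longrightarrow> reduced_trajectory T p' q' h' \<theta>' \<longrightarrow>
     h ` {0..T} \<subseteq> {m..M} \<longrightarrow> h' ` {0..T} \<subseteq> {m..M} \<longrightarrow>
     \<bar>p\<bar> \<le> B \<longrightarrow> \<bar>q\<bar> \<le> B \<longrightarrow> \<bar>p'\<bar> \<le> B \<longrightarrow> \<bar>q'\<bar> \<le> B \<longrightarrow> s \<in> {0..T} \<longrightarrow>
     (h' s - h s)\<^sup>2 + (\<theta>' s - \<theta> s)\<^sup>2 \<le> C1 * initial_gap p q h \<theta> p' q' h' \<theta>'"
    using trajectory_gap_bound[OF mM] by (elim exE conjE) (rule that)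
  obtain C2 where C2: "0 \<le> C2" and C2': "\<forall>p q h \<theta> p' q' h' \<theta>'.
     reduced_trajectory 1 p q h \<theta> \<longrightarrow> reduced_trajectory 1 p' q' h' \<theta>' \<longrightarrow>
     h ` {0..1} \<subseteq> {m..M} \<longrightarrow> h' ` {0..1} \<subseteq> {m..M} \<longrightarrow>
     \<bar>p\<bar> \<le> B \<longrightarrow> \<bar>q\<bar> \<le> B \<longrightarrow> \<bar>p'\<bar> \<le> B \<longrightarrow> \<bar>q'\<bar> \<le> B \<longrightarrow>
     \<bar>reduced_action p' q' h' \<theta>' - reduced_action p q h \<theta>
        - (\<theta> 1 * (h' 1 - h 1) - \<theta> 0 * (h' 0 - h 0)
           - (p' - p) * integral {0..1} (\<lambda>s. p * (tan (h s))\<^sup>2 + q)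
           - (q' - q) * integral {0..1} (\<lambda>s. q * (cot (h s))\<^sup>2 + p))\<bar>
       \<le> C2 * initial_gap p q h \<theta> p' q' h' \<theta>'"
    using first_variation[OF mM] by (elim exE conjE) (rule that)
  define C where "C = 2 * C1 + 3 * C2"
  have C: "0 \<le> C" using C1 C2 by (simp add: C_def)
  have lip: "\<bar>H w' 1 - H w 1\<bar> \<le> C * (norm (fst w' - fst w) + \<bar>\<Theta> w' - \<Theta> w\<bar>)"
      "\<bar>T w' 1 - T w 1\<bar> \<le> C * (norm (fst w' - fst w) + \<bar>\<Theta> w' - \<Theta> w\<bar>)" if w: "w \<in> W'" "w' \<in> W'" for w w'
  proof -
    let ?n = "norm (fst w' - fst w)" and ?t = "\<bar>\<Theta> w' - \<Theta> w\<bar>"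
    have wW: "w \<in> W" "w' \<in> W" using w W' by blast+
    have "(H w' 1 - H w 1)\<^sup>2 + (T w' 1 - T w 1)\<^sup>2 \<le> C1 * gap w w'"
      unfolding gap_def using trw[OF w(1)] trw[OF w(2)] tube[OF w(1)] tube[OF w(2)]
      by (intro C1'[rule_format, of 1 _ _ _ _ _ _ _ _ 1]) auto
    also have "\<dots> \<le> C1 * (2 * (?n + ?t))\<^sup>2"
    proof (rule mult_left_mono)
      have "3 * ?n\<^sup>2 + ?t\<^sup>2 \<le> (2 * (?n + ?t))\<^sup>2"
        by (simp add: power_mult_distrib power2_sum)
      then have "3 * ?n\<^sup>2 + (\<Theta> w' - \<Theta> w)\<^sup>2 \<le> (2 * (?n + ?t))\<^sup>2"
        by (simp only: power2_abs)
      then show "gap w w' \<le> (2 * (?n + ?t))\<^sup>2" using gap_le[OF wW] by linarith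
    qed (use C1 in simp)
    also have "\<dots> \<le> C1\<^sup>2 * (2 * (?n + ?t))\<^sup>2"
      using C1 by (intro mult_right_mono) (auto simp: power2_eq_square)
    also have "\<dots> = (2 * C1 * (?n + ?t))\<^sup>2"
      by (simp only: power_mult_distrib mult.assoc mult.commute mult.left_commute)
    also have "\<dots> \<le> (C * (?n + ?t))\<^sup>2"
      using C1 C2 by (intro power_mono mult_right_mono) (auto simp: C_def)
    finally have *: "(H w' 1 - H w 1)\<^sup>2 + (T w' 1 - T w 1)\<^sup>2 \<le> (C * (?n + ?t))\<^sup>2" .
    have nn: "0 \<le> C * (?n + ?t)" using C by simp
    show "\<bar>H w' 1 - H w 1\<bar> \<le> C * (?n + ?t)" "\<bar>T w' 1 - T w 1\<bar> \<le> C * (?n + ?t)"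
      using * zero_le_power2[of "H w' 1 - H w 1"] zero_le_power2[of "T w' 1 - T w 1"]
      by (intro power2_le_imp_le[OF _ nn]; simp only: power2_abs; linarith)+
  qed
  have variation: "\<bar>A w' - A w
        - (T w 1 * (H w' 1 - H w 1) - T w 0 * (H w' 0 - H w 0)
           - (psi1_of (fst w') - psi1_of (fst w)) * integral {0..1} (\<lambda>s. psi1_of (fst w) * (tan (H w s))\<^sup>2 + psi2_of (fst w))
           - (psi2_of (fst w') - psi2_of (fst w)) * integral {0..1} (\<lambda>s. psi2_of (fst w) * (cot (H w s))\<^sup>2 + psi1_of (fst w)))\<bar>
       \<le> C2 * gap w w'" if w: "w \<in> W'" "w' \<in> W'" for w w'
    unfolding gap_def A_def using trw[OF w(1)] trw[OF w(2)] tube[OF w(1)] tube[OF w(2)]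
    by (intro C2'[rule_format]) auto
  have c\<Theta>: "isCont \<Theta> ?w0"
    using cont W by (simp add: continuous_on_eq_continuous_at)
  have "(A has_derivative (\<lambda>(dy, d\<eta>). l dy + T ?w0 1 * d\<eta>)) (at ?w0)"
  proof (rule has_derivative_of_quadratic_error[where P = "\<lambda>w. T w 1" and \<Theta> = \<Theta> and C = C, OF oW' W'(2)])
    show "continuous_on W' \<Theta>" using cont W'(1) by (rule continuous_on_subset)
    show "isCont (\<lambda>w. T w 1) ?w0"
      unfolding isCont_def
    proof (rule LIM_zero_cancel, rule Lim_null_comparison)
      have "\<forall>\<^sub>F w in at ?w0. w \<in> W'" using oW' W'(2) by (rule eventually_at_in_open')
      then show "\<forall>\<^sub>F w in at ?w0. norm (T w 1 - T ?w0 1) \<le> C * (norm (fst w - y0) + \<bar>\<Theta> w - \<Theta> ?w0\<bar>)"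
        by eventually_elim (use lip(2)[OF W'(2)] in auto)
      have "isCont (\<lambda>w. C * (norm (fst w - y0) + \<bar>\<Theta> w - \<Theta> ?w0\<bar>)) ?w0"
        by (intro continuous_intros c\<Theta>)
      then show "((\<lambda>w. C * (norm (fst w - y0) + \<bar>\<Theta> w - \<Theta> ?w0\<bar>)) \<longlongrightarrow> 0) (at ?w0)"
        by (simp add: isCont_def)
    qed
    show "bounded_linear l"
      unfolding l_def
      by (intro bounded_linear_sub bounded_linear_const_mult bounded_linear_mult_const
          bounded_linear_fst_comp bounded_linear_snd_comp bounded_linear_ident)
    show "0 \<le> C" by (rule C)
    show "\<bar>\<eta>' - \<eta>\<bar> \<le> C * (norm (y' - y) + \<bar>\<Theta> (y', \<eta>') - \<Theta> (y, \<eta>)\<bar>)"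
      if "(y, \<eta>) \<in> W'" "(y', \<eta>') \<in> W'" for y \<eta> y' \<eta>'
      using lip(1)[OF that] bc[OF subsetD[OF W'(1) that(1)]] bc[OF subsetD[OF W'(1) that(2)]] by simp
    show "\<bar>A (y, \<eta>') - A (y, \<eta>) - T (y, \<eta>) 1 * (\<eta>' - \<eta>)\<bar> \<le> C * (\<Theta> (y, \<eta>') - \<Theta> (y, \<eta>))\<^sup>2"
      if w: "(y, \<eta>) \<in> W'" "(y, \<eta>') \<in> W'" for y \<eta> \<eta>'
    proof -
      have wW: "(y, \<eta>) \<in> W" "(y, \<eta>') \<in> W" using w W' by blast+
      have "\<bar>A (y, \<eta>') - A (y, \<eta>) - T (y, \<eta>) 1 * (\<eta>' - \<eta>)\<bar> \<le> C2 * (\<Theta> (y, \<eta>') - \<Theta> (y, \<eta>))\<^sup>2"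
        using variation[OF w] bc[OF wW(1)] bc[OF wW(2)] unfolding gap[OF wW] by simp
      also have "\<dots> \<le> C * (\<Theta> (y, \<eta>') - \<Theta> (y, \<eta>))\<^sup>2"
        using C1 C2 by (intro mult_right_mono) (auto simp: C_def)
      finally show ?thesis .
    qed
    show "\<bar>A (y, \<eta>) - A ?w0 - T ?w0 1 * (\<eta> - \<eta>0) - l (y - y0)\<bar>
         \<le> C * ((norm (y - y0))\<^sup>2 + (\<Theta> (y, \<eta>) - \<Theta> ?w0)\<^sup>2)" if w: "(y, \<eta>) \<in> W'" for y \<eta>
    proof -
      have wW: "(y, \<eta>) \<in> W" using w W' by blast
      have "A (y, \<eta>) - A ?w0 - T ?w0 1 * (\<eta> - \<eta>0) - l (y - y0) = A (y, \<eta>) - A ?w0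
        - (T ?w0 1 * (H (y, \<eta>) 1 - H ?w0 1) - T ?w0 0 * (H (y, \<eta>) 0 - H ?w0 0)
           - (psi1_of y - psi1_of y0) * I1 - (psi2_of y - psi2_of y0) * I2)"
        using bc[OF wW] bc[OF W(2)] by (simp add: l_def algebra_simps)
      then have "\<bar>A (y, \<eta>) - A ?w0 - T ?w0 1 * (\<eta> - \<eta>0) - l (y - y0)\<bar> \<le> C2 * gap ?w0 (y, \<eta>)"
        using variation[OF W'(2) w] unfolding I1_def I2_def by simp
      also have "\<dots> \<le> C2 * (3 * (norm (y - y0))\<^sup>2 + (\<Theta> (y, \<eta>) - \<Theta> ?w0)\<^sup>2)"
        using gap_le[OF W(2) wW] C2 by (intro mult_left_mono) auto
      also have "\<dots> \<le> (3 * C2) * ((norm (y - y0))\<^sup>2 + (\<Theta> (y, \<eta>) - \<Theta> ?w0)\<^sup>2)"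
        using C2 by (simp add: algebra_simps)
      also have "\<dots> \<le> C * ((norm (y - y0))\<^sup>2 + (\<Theta> (y, \<eta>) - \<Theta> ?w0)\<^sup>2)"
        using C1 by (intro mult_right_mono) (auto simp: C_def)
      finally show ?thesis .
    qed
  qed
  then show ?thesis unfolding A_def l_def .
qed

text \<open>
  The momenta \<open>\<psi>1\<close> and \<open>\<psi>2\<close> are constant along solutions and may be replaced by their initial values.
\<close>
lemma modified_action_value_reduces:
  assumes "modified_action_value \<zeta>1 \<zeta>2 \<eta>0 \<eta> \<psi>1 \<psi>2 1 \<theta>0 v"
  shows "\<exists>h \<theta>. reduced_trajectory 1 \<psi>1 \<psi>2 h \<theta> \<and> h 0 = \<eta>0 \<and> h 1 = \<eta> \<and> \<theta> 0 = \<theta>0 \<and>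
    v = \<psi>1 * \<zeta>1 + \<psi>2 * \<zeta>2 + reduced_action \<psi>1 \<psi>2 h \<theta>"
proof -
  obtain z1 z2 h p1 p2 \<theta> where sol: "hamiltonian_solution 1 z1 z2 h p1 p2 \<theta>"
    and bc: "h 0 = \<eta>0" "h 1 = \<eta>" "p1 0 = \<psi>1" "p2 0 = \<psi>2" "\<theta> 0 = \<theta>0"
    and v: "v = \<psi>1 * \<zeta>1 + \<psi>2 * \<zeta>2 + integral {0..1} (\<lambda>s. \<theta> s * vector_derivative h (at s within {0..1})
                                 - Ham (z1 s) (z2 s) (h s) (p1 s) (p2 s) (\<theta> s))"
    using assms unfolding modified_action_value_def by (elim exE conjE) (rule that)
  have const: "u s = u 0" if u: "\<And>s. s \<in> {0..1} \<Longrightarrow> (u has_real_derivative 0) (at s within {0..1})"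
    and s: "s \<in> {0..1}" for u :: "real \<Rightarrow> real" and s
  proof -
    obtain c where c: "\<forall>x\<in>{0..1}. u x = c"
      using has_field_derivative_zero_constant[OF convex_closed_interval u] by blast
    show ?thesis using c[rule_format, OF s] c[rule_format, of 0] by simp
  qed
  have p: "p1 s = \<psi>1" "p2 s = \<psi>2" if "s \<in> {0..1}" for s
    using const[of p1 s] const[of p2 s] sol that bc unfolding hamiltonian_solution_def by auto
  have tr: "reduced_trajectory 1 \<psi>1 \<psi>2 h \<theta>"
    using sol p unfolding hamiltonian_solution_def reduced_trajectory_def force_def by simp
  have "\<theta> s * vector_derivative h (at s within {0..1}) - Ham (z1 s) (z2 s) (h s) (p1 s) (p2 s) (\<theta> s)
      = 2 * (\<theta> s)\<^sup>2 - potential \<psi>1 \<psi>2 (h s)" if s: "s \<in> {0..1}" for s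
  proof -
    have "vector_derivative h (at s within {0..1}) = 4 * \<theta> s"
      using reduced_trajectoryD(2)[OF tr s] s
      by (intro vector_derivative_within_closed_interval)
        (auto simp: has_real_derivative_iff_has_vector_derivative)
    then show ?thesis
      by (simp add: p[OF s] Ham_def potential_def power2_eq_square field_simps)
  qed
  then have "v = \<psi>1 * \<zeta>1 + \<psi>2 * \<zeta>2 + reduced_action \<psi>1 \<psi>2 h \<theta>"
    unfolding v reduced_action_def by (auto intro: Henstock_Kurzweil_Integration.integral_cong)
  then show ?thesis using tr bc by blast
qed

lemma deriv_along_curve:
  fixes \<gamma> :: "real \<Rightarrow> 'a::real_normed_vector"
  assumes F: "(F has_derivative D) (at (\<gamma> t))" and \<gamma>: "(\<gamma> has_derivative \<gamma>') (at t)"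
    and D: "\<And>s. D (\<gamma>' s) = k * s"
  shows "deriv (\<lambda>x. F (\<gamma> x)) t = (k::real)"
proof -
  have "((\<lambda>x. F (\<gamma> x)) has_derivative (\<lambda>s. D (\<gamma>' s))) (at t)"
    by (rule has_derivative_compose[OF \<gamma> F])
  then have "((\<lambda>x. F (\<gamma> x)) has_real_derivative k) (at t)"
    unfolding D has_field_derivative_def .
  then show ?thesis by (rule DERIV_imp_deriv)
qed

theorem theorem5:
  fixes g :: "real \<Rightarrow> real \<Rightarrow> real \<Rightarrow> real \<Rightarrow> real \<Rightarrow> real \<Rightarrow> real \<Rightarrow> real"
    and f :: "real \<Rightarrow> real \<Rightarrow> real \<Rightarrow> real \<Rightarrow> real \<Rightarrow> real \<Rightarrow> real"
    and D :: "(real \<times> real \<times> real \<times> real \<times> real \<times> real \<times> real) set"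
    and U :: "(real \<times> real \<times> real \<times> real \<times> real \<times> real) set"
  assumes "modified_action D g"
    and "open U"
    and "\<And>\<zeta>1 \<zeta>2 \<eta>0 \<eta> \<psi>1 \<psi>2.
           (\<zeta>1, \<zeta>2, \<eta>0, \<eta>, \<psi>1, \<psi>2) \<in> U \<Longrightarrow> (\<zeta>1, \<zeta>2, \<eta>0, \<eta>, \<psi>1, \<psi>2, 1) \<in> D"
    and "\<And>\<zeta>1 \<zeta>2 \<eta>0 \<eta> \<psi>1 \<psi>2. f \<zeta>1 \<zeta>2 \<eta>0 \<eta> \<psi>1 \<psi>2 = g \<zeta>1 \<zeta>2 \<eta>0 \<eta> \<psi>1 \<psi>2 1"
  shows "solves_generalized_HJ U f"
proof -
  obtain \<theta>0 where c\<theta>: "continuous_on D \<theta>0"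
    and val: "\<And>a b c e p q t. (a, b, c, e, p, q, t) \<in> D \<Longrightarrow>
      modified_action_value a b c e p q t (\<theta>0 (a, b, c, e, p, q, t)) (g a b c e p q t)"
    using assms(1) unfolding modified_action_def by fast
  \<comment> \<open>Reordering of the coordinates; its inverse is \<open>\<pi>\<close> below.\<close>
  define \<sigma> :: "boundary_data \<times> real \<Rightarrow> real \<times> real \<times> real \<times> real \<times> real \<times> real"
    where "\<sigma> = (\<lambda>w. (fst (fst w), fst (snd (fst w)), initial_eta (fst w), snd w, psi1_of (fst w), psi2_of (fst w)))"
  define \<Theta> where "\<Theta> = (\<lambda>w. \<theta>0 (fst (fst w), fst (snd (fst w)), initial_eta (fst w), snd w,
      psi1_of (fst w), psi2_of (fst w), 1))"
  define W where "W = \<sigma> -` U"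
  have "open W" unfolding W_def \<sigma>_def by (rule open_vimage[OF assms(2)]) (intro continuous_intros)
  have WD: "(fst (fst w), fst (snd (fst w)), initial_eta (fst w), snd w, psi1_of (fst w), psi2_of (fst w), 1) \<in> D"
    if "w \<in> W" for w
    using that assms(3) by (simp add: W_def \<sigma>_def)
  have c\<Theta>: "continuous_on W \<Theta>"
    unfolding \<Theta>_def by (rule continuous_on_compose2[OF c\<theta>]) (use WD in \<open>auto intro!: continuous_intros\<close>)
  define good where "good = (\<lambda>w h \<theta>. reduced_trajectory 1 (psi1_of (fst w)) (psi2_of (fst w)) h \<theta> \<and>
      h 0 = initial_eta (fst w) \<and> h 1 = snd w \<and> \<theta> 0 = \<Theta> w \<and>
      g (fst (fst w)) (fst (snd (fst w))) (initial_eta (fst w)) (snd w) (psi1_of (fst w)) (psi2_of (fst w)) 1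
        = psi1_of (fst w) * fst (fst w) + psi2_of (fst w) * fst (snd (fst w))
          + reduced_action (psi1_of (fst w)) (psi2_of (fst w)) h \<theta>)"
  have "\<exists>h \<theta>. good w h \<theta>" if "w \<in> W" for w
    unfolding good_def \<Theta>_def by (rule modified_action_value_reduces[OF val[OF WD[OF that]]])
  then obtain H T where good: "\<And>w. w \<in> W \<Longrightarrow> good w (H w) (T w)" by metis
  note good' = good[unfolded good_def]
  let ?F = "\<lambda>(\<zeta>1, \<zeta>2, \<eta>0, \<eta>, \<psi>1, \<psi>2). f \<zeta>1 \<zeta>2 \<eta>0 \<eta> \<psi>1 \<psi>2"
  show ?thesis
    unfolding solves_generalized_HJ_def
  proof clarify
    fix \<zeta>1 \<zeta>2 \<eta>0 \<eta> \<psi>1 \<psi>2 assume x: "(\<zeta>1, \<zeta>2, \<eta>0, \<eta>, \<psi>1, \<psi>2) \<in> U"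
    define y0 where "y0 = (\<zeta>1, \<zeta>2, \<eta>0, \<psi>1, \<psi>2)"
    define \<pi> where "\<pi> = (\<lambda>x :: real \<times> real \<times> real \<times> real \<times> real \<times> real.
      ((fst x, fst (snd x), fst (snd (snd x)), fst (snd (snd (snd (snd x)))), snd (snd (snd (snd (snd x))))),
       fst (snd (snd (snd x)))))"
    let ?x = "(\<zeta>1, \<zeta>2, \<eta>0, \<eta>, \<psi>1, \<psi>2)" and ?w = "(y0, \<eta>)"
    have \<pi>x: "\<pi> ?x = ?w" by (simp add: \<pi>_def y0_def)
    have w: "?w \<in> W" using x by (simp add: W_def \<sigma>_def y0_def)
    define I1 where "I1 = integral {0..1} (\<lambda>s. \<psi>1 * (tan (H ?w s))\<^sup>2 + \<psi>2)"
    define I2 where "I2 = integral {0..1} (\<lambda>s. \<psi>2 * (cot (H ?w s))\<^sup>2 + \<psi>1)"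
    have dA: "((\<lambda>w. reduced_action (psi1_of (fst w)) (psi2_of (fst w)) (H w) (T w)) has_derivative
      (\<lambda>(dy, d\<eta>). (- T ?w 0 * initial_eta dy - psi1_of dy * I1 - psi2_of dy * I2)
         + T ?w 1 * d\<eta>)) (at ?w)"
    proof -
      have tr: "reduced_trajectory 1 (psi1_of y) (psi2_of y) (H (y, e)) (T (y, e))"
        and bc: "H (y, e) 0 = initial_eta y \<and> H (y, e) 1 = e \<and> T (y, e) 0 = \<Theta> (y, e)"
        if "(y, e) \<in> W" for y e
        using good'[OF that] by simp_all
      have I: "I1 = integral {0..1} (\<lambda>s. psi1_of y0 * (tan (H ?w s))\<^sup>2 + psi2_of y0)"
        "I2 = integral {0..1} (\<lambda>s. psi2_of y0 * (cot (H ?w s))\<^sup>2 + psi1_of y0)"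
        by (simp_all add: I1_def I2_def y0_def)
      show ?thesis
        unfolding I by (rule action_branch_has_derivative[OF \<open>open W\<close> w c\<Theta> tr bc])
    qed
    have d\<pi>: "(\<pi> has_derivative \<pi>) (at ?x)"
      unfolding \<pi>_def by (intro derivative_intros)
    define dF where "dF = (\<lambda>(d1, d2, dc, de, dp, dq).
       \<psi>1 * d1 + \<zeta>1 * dp + \<psi>2 * d2 + \<zeta>2 * dq - T ?w 0 * dc - dp * I1 - dq * I2 + T ?w 1 * de)"
    define A where "A = (\<lambda>w. reduced_action (psi1_of (fst w)) (psi2_of (fst w)) (H w) (T w))"
    have dA\<pi>: "((\<lambda>x. A (\<pi> x)) has_derivative (\<lambda>dx. (\<lambda>(dy, d\<eta>).
        (- T ?w 0 * initial_eta dy - psi1_of dy * I1 - psi2_of dy * I2) + T ?w 1 * d\<eta>) (\<pi> dx))) (at ?x)"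
      by (rule has_derivative_compose[OF d\<pi>]) (use dA in \<open>simp add: \<pi>x A_def\<close>)
    have "((\<lambda>x. fst (snd (snd (snd (snd x)))) * fst x + snd (snd (snd (snd (snd x)))) * fst (snd x)
         + A (\<pi> x)) has_derivative dF) (at ?x)"
      by (rule has_derivative_eq_rhs, (rule derivative_intros dA\<pi>)+)
        (auto simp: dF_def \<pi>_def fun_eq_iff algebra_simps)
    then have dF: "(?F has_derivative dF) (at ?x)"
    proof (rule has_derivative_transform_within_open[OF _ assms(2) x])
      fix x assume "x \<in> U"
      then have "\<pi> x \<in> W" by (cases x) (simp add: W_def \<sigma>_def \<pi>_def)
      from good'[OF this]
      show "fst (snd (snd (snd (snd x)))) * fst x + snd (snd (snd (snd (snd x)))) * fst (snd x)
         + A (\<pi> x) = ?F x"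
        using assms(4) by (cases x) (simp add: \<pi>_def A_def)
    qed
    \<comment> \<open>The gradient is \<open>(\<psi>1, \<psi>2, \<theta>(1))\<close> in \<open>(\<zeta>1, \<zeta>2, \<eta>)\<close> and, in \<open>(\<psi>1, \<psi>2)\<close>, the initial angles
      \<open>\<zeta>i - Ii\<close> of the trajectory.\<close>
    have curve: "((\<lambda>x. (x, \<zeta>2, \<eta>0, \<eta>, \<psi>1, \<psi>2)) has_derivative (\<lambda>s. (s, 0, 0, 0, 0, 0))) (at \<zeta>1)"
      by (intro has_derivative_Pair has_derivative_ident has_derivative_const)
    have d1: "deriv (\<lambda>x. f x \<zeta>2 \<eta>0 \<eta> \<psi>1 \<psi>2) \<zeta>1 = \<psi>1"
      using deriv_along_curve[of ?F dF "\<lambda>x. (x, \<zeta>2, \<eta>0, \<eta>, \<psi>1, \<psi>2)" \<zeta>1 "\<lambda>s. (s, 0, 0, 0, 0, 0)" \<psi>1, OF _ curve] dF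
      by (simp add: dF_def algebra_simps)
    have curve: "((\<lambda>x. (\<zeta>1, x, \<eta>0, \<eta>, \<psi>1, \<psi>2)) has_derivative (\<lambda>s. (0, s, 0, 0, 0, 0))) (at \<zeta>2)"
      by (intro has_derivative_Pair has_derivative_ident has_derivative_const)
    have d2: "deriv (\<lambda>x. f \<zeta>1 x \<eta>0 \<eta> \<psi>1 \<psi>2) \<zeta>2 = \<psi>2"
      using deriv_along_curve[of ?F dF "\<lambda>x. (\<zeta>1, x, \<eta>0, \<eta>, \<psi>1, \<psi>2)" \<zeta>2 "\<lambda>s. (0, s, 0, 0, 0, 0)" \<psi>2, OF _ curve] dF
      by (simp add: dF_def algebra_simps)
    have curve: "((\<lambda>x. (\<zeta>1, \<zeta>2, \<eta>0, x, \<psi>1, \<psi>2)) has_derivative (\<lambda>s. (0, 0, 0, s, 0, 0))) (at \<eta>)"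
      by (intro has_derivative_Pair has_derivative_ident has_derivative_const)
    have d3: "deriv (\<lambda>x. f \<zeta>1 \<zeta>2 \<eta>0 x \<psi>1 \<psi>2) \<eta> = T ?w 1"
      using deriv_along_curve[of ?F dF "\<lambda>x. (\<zeta>1, \<zeta>2, \<eta>0, x, \<psi>1, \<psi>2)" \<eta> "\<lambda>s. (0, 0, 0, s, 0, 0)" "T ?w 1", OF _ curve] dF
      by (simp add: dF_def algebra_simps)
    have curve: "((\<lambda>x. (\<zeta>1, \<zeta>2, \<eta>0, \<eta>, x, \<psi>2)) has_derivative (\<lambda>s. (0, 0, 0, 0, s, 0))) (at \<psi>1)"
      by (intro has_derivative_Pair has_derivative_ident has_derivative_const)
    have d4: "deriv (\<lambda>x. f \<zeta>1 \<zeta>2 \<eta>0 \<eta> x \<psi>2) \<psi>1 = \<zeta>1 - I1"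
      using deriv_along_curve[of ?F dF "\<lambda>x. (\<zeta>1, \<zeta>2, \<eta>0, \<eta>, x, \<psi>2)" \<psi>1 "\<lambda>s. (0, 0, 0, 0, s, 0)" "\<zeta>1 - I1", OF _ curve] dF
      by (simp add: dF_def algebra_simps)
    have curve: "((\<lambda>x. (\<zeta>1, \<zeta>2, \<eta>0, \<eta>, \<psi>1, x)) has_derivative (\<lambda>s. (0, 0, 0, 0, 0, s))) (at \<psi>2)"
      by (intro has_derivative_Pair has_derivative_ident has_derivative_const)
    have d5: "deriv (\<lambda>x. f \<zeta>1 \<zeta>2 \<eta>0 \<eta> \<psi>1 x) \<psi>2 = \<zeta>2 - I2"
      using deriv_along_curve[of ?F dF "\<lambda>x. (\<zeta>1, \<zeta>2, \<eta>0, \<eta>, \<psi>1, x)" \<psi>2 "\<lambda>s. (0, 0, 0, 0, 0, s)" "\<zeta>2 - I2", OF _ curve] dF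
      by (simp add: dF_def algebra_simps)
    have gw: "reduced_trajectory 1 \<psi>1 \<psi>2 (H ?w) (T ?w)" "H ?w 1 = \<eta>"
      "f \<zeta>1 \<zeta>2 \<eta>0 \<eta> \<psi>1 \<psi>2 = \<psi>1 * \<zeta>1 + \<psi>2 * \<zeta>2 + reduced_action \<psi>1 \<psi>2 (H ?w) (T ?w)"
      using good'[OF w] assms(4) by (auto simp: y0_def)
    have "Ham \<zeta>1 \<zeta>2 \<eta> \<psi>1 \<psi>2 (T ?w 1) = 2 * (T ?w 1)\<^sup>2 + potential \<psi>1 \<psi>2 (H ?w 1)"
      by (simp add: Ham_def potential_def gw(2) field_simps)
    also have "\<dots> = reduced_action \<psi>1 \<psi>2 (H ?w) (T ?w) + \<psi>1 * I1 + \<psi>2 * I2"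
      unfolding I1_def I2_def by (rule energy_equals_action_balance[OF gw(1)])
    finally have "\<psi>1 * (\<zeta>1 - I1) + \<psi>2 * (\<zeta>2 - I2) + Ham \<zeta>1 \<zeta>2 \<eta> \<psi>1 \<psi>2 (T ?w 1)
        = f \<zeta>1 \<zeta>2 \<eta>0 \<eta> \<psi>1 \<psi>2"
      unfolding gw(3) by (simp add: algebra_simps)
    then show "?F differentiable at ?x \<and>
        \<psi>1 * deriv (\<lambda>x. f \<zeta>1 \<zeta>2 \<eta>0 \<eta> x \<psi>2) \<psi>1 +
        \<psi>2 * deriv (\<lambda>x. f \<zeta>1 \<zeta>2 \<eta>0 \<eta> \<psi>1 x) \<psi>2 +
        Ham \<zeta>1 \<zeta>2 \<eta>
          (deriv (\<lambda>x. f x \<zeta>2 \<eta>0 \<eta> \<psi>1 \<psi>2) \<zeta>1)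
          (deriv (\<lambda>x. f \<zeta>1 x \<eta>0 \<eta> \<psi>1 \<psi>2) \<zeta>2)
          (deriv (\<lambda>x. f \<zeta>1 \<zeta>2 \<eta>0 x \<psi>1 \<psi>2) \<eta>)
        = f \<zeta>1 \<zeta>2 \<eta>0 \<eta> \<psi>1 \<psi>2"
      using dF unfolding d1 d2 d3 d4 d5 differentiable_def by blast
  qed
qed

end
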